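(* Let $\mathcal F$ be an arbitrary set and let $\{\mathbb H_N'\}_{N\ge1}$ be a sequence of mappings from the underlying probability space into $l^\infty(\mathcal F)$ such that each $\mathbb H_N'$ depends on the sample point only through $\mathbf Y_N,\mathbf X_N,\mathbf S_N$ and such that $\mathbb H_N'f$ is measurable for every $N$ and every $f\in\mathcal F$. The following three conditions are equivalent (in each of two versions: everywhere "in probability", or everywhere "almost surely"): (i) $\{\mathbb H_N'\}$ is conditionally asymptotically tight: for every $\eta>0$ there is a compact set $K\subset l^\infty(\mathcal F)$ such that for every $\delta>0$ there is a sequence of random variables $\widetilde A_N\to0$ in probability (almost surely) with $P_d\{\mathbb H_N'\in K^\delta\}+\widetilde A_N\ge1-\eta$ for every $N=1,2,\dots$. (ii) The marginals are conditionally asymptotically tight, i.e. for every $f\in\mathcal F$ and $\eta>0$ there is a constant $M>0$ such that $$P_d\{|\mathbb H_N'f|\le M\}+\widetilde B_N\ge1-\eta\quad\text{for every }N=1,2,\dots$$ for some sequence of random variables $\widetilde B_N$ which goes to zero in probability (almost surely); and there exists a semimetric $\rho$ on $\mathcal F$ for which $\mathcal F$ is totally bounded and for which $\{\mathbb H_N'\}$ is conditionally asymptotically $\rho$-equicontinuous, i.e. for every $\epsilon,\eta>0$ there is a $\delta>0$ such that $$P_d\Big\{\sup_{f,g\in\mathcal F:\rho(f,g)<\delta}|\mathbb H_N'f-\mathbb H_N'g|>\epsilon\Big\}<\eta+\widetilde C_N\quad\text{for every }N=1,2,\dots$$ for some sequence of random variables $\widetilde C_N$ which goes to zero in probability (almost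 surely). (iii) The marginals are conditionally asymptotically tight (as defined in (ii)), and for every $\epsilon,\eta>0$ there is a finite partition $\mathcal F=\cup_{i=1}^k\mathcal F_i$ such that $$P_d\Big\{\sup_{1\le i\le k}\sup_{f,g\in\mathcal F_i}|\mathbb H_N'f-\mathbb H_N'g|>\epsilon\Big\}<\eta+\widetilde D_N\quad\text{for every }N=1,2,\dots$$ for some sequence of random variables $\widetilde D_N$ which goes to zero in probability (almost surely).
   Context: Probability framework. $(\mathcal Y,\mathcal A)$ and $(\mathcal X,\mathcal B)$ are measurable spaces. The underlying probability space is $\prod_{i=1}^\infty(\Omega_{y,x},\mathcal A_{y,x},P_{y,x})\times(\Omega_d,\mathcal A_d,P_d)$ with product measure $P$. The pairs $(Y_i,X_i)$, $i\ge1$, are the coordinate projections on the first infinitely many coordinates; they are i.i.d. with values in $\mathcal Y\times\mathcal X$. Put $\mathbf Y_N=(Y_1,\dots,Y_N)$, $\mathbf X_N=(X_1,\dots,X_N)$. $D$ is a uniform-$[0,1]$ random variable depending only on the last coordinate. A sampling design gives, for each $N$, selection probabilities $\mathfrak p_N(\mathbf s;\mathbf X_N)\ge0$, $\mathbf s\in\{0,1\}^N$, summing to $1$; designs are assumed measurable, i.e. $\mathbf X_N\mapsto\mathfrak p_N(\mathbf s;\mathbf X_N)$ is measurable for each $\mathbf s$. Enumerating $\{0,1\}^N$ as $\mathbf s^{(1)},\dots,\mathbf s^{(2^N)}$, the vector of inclusion indicators $\mathbf S_N$ equals $\mathbf s^{(1)}$ if $D\le\mathfrak p_N(\mathbf s^{(1)};\mathbf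 X_N)$, and $\mathbf s^{(i)}$ if $\sum_{j<i}\mathfrak p_N(\mathbf s^{(j)};\mathbf X_N)<D\le\sum_{j\le i}\mathfrak p_N(\mathbf s^{(j)};\mathbf X_N)$. For any (not necessarily measurable) function $g$, $E_dg(\mathbf S_N,\mathbf Y_N,\mathbf X_N):=\sum_{\mathbf s}g(\mathbf s,\mathbf Y_N,\mathbf X_N)\mathfrak p_N(\mathbf s;\mathbf X_N)$, a (possibly nonmeasurable) function of $(\mathbf Y_N,\mathbf X_N)$; $P_d$ of an event determined by $(\mathbf S_N,\mathbf Y_N,\mathbf X_N)$ is $E_d$ of its indicator. $l^\infty(\mathcal F)$ is the space of bounded real functions on $\mathcal F$ with norm $\|z\|_{\mathcal F}=\sup_{f\in\mathcal F}|z(f)|$; $\mathbb H_N'f$ denotes the value of $\mathbb H_N'$ at $f$. $K^\delta:=\{z\in l^\infty(\mathcal F):\|z-z'\|_{\mathcal F}<\delta\text{ for some }z'\in K\}$. *)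

theory Defs
  imports "HOL-Probability.Probability"
begin

section \<open>The underlying probability space\<close>

text \<open>
  The pairs are indexed by the positive integers. A sample point is a sequence of pairs together
  with a point of the randomisation space, and \<open>Q\<close> is the common law of the pairs.
\<close>

definition sample_space :: "('y \<times> 'x) measure \<Rightarrow> 'd measure \<Rightarrow> ((nat \<Rightarrow> 'y \<times> 'x) \<times> 'd) measure" where
  "sample_space Q Md = (\<Pi>\<^sub>M i\<in>{1..}. Q) \<Otimes>\<^sub>M Md"

definition Yvec :: "nat \<Rightarrow> (nat \<Rightarrow> 'y \<times> 'x) \<times> 'd \<Rightarrow> nat \<Rightarrow> 'y" where
  "Yvec N \<omega> = (\<lambda>i\<in>{1..N}. fst (fst \<omega> i))"

definition Xvec :: "nat \<Rightarrow> (nat \<Rightarrow> 'y \<times> 'x) \<times> 'd \<Rightarrow> nat \<Rightarrow> 'x" where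
  "Xvec N \<omega> = (\<lambda>i\<in>{1..N}. snd (fst \<omega> i))"

definition uniform01 :: "'d measure \<Rightarrow> ('d \<Rightarrow> real) \<Rightarrow> bool" where
  "uniform01 Md D \<longleftrightarrow> D \<in> borel_measurable Md \<and> distr Md borel D = uniform_measure lborel {0..1}"


section \<open>Sampling designs\<close>

definition binvecs :: "nat \<Rightarrow> (nat \<Rightarrow> nat) set" where
  "binvecs N = {1..N} \<rightarrow>\<^sub>E {0, 1}"

definition sampling_design :: "'x measure \<Rightarrow> (nat \<Rightarrow> (nat \<Rightarrow> nat) \<Rightarrow> (nat \<Rightarrow> 'x) \<Rightarrow> real) \<Rightarrow> bool" where
  "sampling_design MX p \<longleftrightarrow>
     (\<forall>N\<ge>1.
        (\<forall>s\<in>binvecs N. p N s \<in> borel_measurable (\<Pi>\<^sub>M i\<in>{1..N}. MX)) \<and>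
        (\<forall>x\<in>space (\<Pi>\<^sub>M i\<in>{1..N}. MX). (\<forall>s\<in>binvecs N. 0 \<le> p N s x) \<and> (\<Sum>s\<in>binvecs N. p N s x) = 1))"

text \<open>
  \<open>enum N 1, \<dots>, enum N (2 ^ N)\<close> is the chosen enumeration of \<open>binvecs N\<close>. The index selected
  by \<open>THE\<close> exists and is unique whenever \<open>D \<le> 1\<close>; on the null set where \<open>D > 1\<close> the value is
  unspecified.
\<close>

definition Svec ::
  "(nat \<Rightarrow> (nat \<Rightarrow> nat) \<Rightarrow> (nat \<Rightarrow> 'x) \<Rightarrow> real) \<Rightarrow> (nat \<Rightarrow> nat \<Rightarrow> nat \<Rightarrow> nat) \<Rightarrow> ('d \<Rightarrow> real) \<Rightarrow>
   nat \<Rightarrow> (nat \<Rightarrow> 'y \<times> 'x) \<times> 'd \<Rightarrow> nat \<Rightarrow> nat" where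
  "Svec p enum D N \<omega> =
     (if D (snd \<omega>) \<le> p N (enum N 1) (Xvec N \<omega>) then enum N 1
      else enum N (THE i. i \<in> {1..2 ^ N} \<and>
                    (\<Sum>j\<in>{1..<i}. p N (enum N j) (Xvec N \<omega>)) < D (snd \<omega>) \<and>
                    D (snd \<omega>) \<le> (\<Sum>j\<in>{1..i}. p N (enum N j) (Xvec N \<omega>))))"

definition E_d ::
  "(nat \<Rightarrow> (nat \<Rightarrow> nat) \<Rightarrow> (nat \<Rightarrow> 'x) \<Rightarrow> real) \<Rightarrow> nat \<Rightarrow>
   ((nat \<Rightarrow> nat) \<Rightarrow> (nat \<Rightarrow> 'y) \<Rightarrow> (nat \<Rightarrow> 'x) \<Rightarrow> real) \<Rightarrow> (nat \<Rightarrow> 'y \<times> 'x) \<times> 'd \<Rightarrow> real" where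
  "E_d p N g \<omega> = (\<Sum>s\<in>binvecs N. g s (Yvec N \<omega>) (Xvec N \<omega>) * p N s (Xvec N \<omega>))"

definition P_d ::
  "(nat \<Rightarrow> (nat \<Rightarrow> nat) \<Rightarrow> (nat \<Rightarrow> 'x) \<Rightarrow> real) \<Rightarrow> nat \<Rightarrow>
   ((nat \<Rightarrow> nat) \<Rightarrow> (nat \<Rightarrow> 'y) \<Rightarrow> (nat \<Rightarrow> 'x) \<Rightarrow> bool) \<Rightarrow> (nat \<Rightarrow> 'y \<times> 'x) \<times> 'd \<Rightarrow> real" where
  "P_d p N E = E_d p N (\<lambda>s y x. of_bool (E s y x))"


section \<open>The two modes of convergence to zero\<close>

definition null_in_probability :: "'a measure \<Rightarrow> (nat \<Rightarrow> 'a \<Rightarrow> real) \<Rightarrow> bool" where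
  "null_in_probability M A \<longleftrightarrow>
     (\<forall>N. A N \<in> borel_measurable M) \<and>
     (\<forall>\<epsilon>>0. (\<lambda>N. measure M {\<omega>\<in>space M. \<bar>A N \<omega>\<bar> > \<epsilon>}) \<longlonglongrightarrow> 0)"

definition null_almost_surely :: "'a measure \<Rightarrow> (nat \<Rightarrow> 'a \<Rightarrow> real) \<Rightarrow> bool" where
  "null_almost_surely M A \<longleftrightarrow>
     (\<forall>N. A N \<in> borel_measurable M) \<and> (AE \<omega> in M. (\<lambda>N. A N \<omega>) \<longlonglongrightarrow> 0)"


section \<open>Bounded functions with the supremum norm\<close>

text \<open>
  Elements of this metric space are the bounded real functions on \<open>F\<close>, made extensional
  (\<open>undefined\<close> off \<open>F\<close>) so that they are determined by their values on \<open>F\<close>.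
\<close>

definition linf :: "'f set \<Rightarrow> ('f \<Rightarrow> real) metric" where
  "linf F = funspace F euclidean_metric"

lemma mem_linf_iff: "z \<in> mspace (linf F) \<longleftrightarrow> z \<in> extensional F \<and> bounded (z ` F)"
proof -
  have "Metric_space.mbounded UNIV dist (z ` F) \<longleftrightarrow> bounded (z ` F)"
    by (metis Metric_space.mbounded_alt Met_TC.Metric_space_axioms bounded_two_points subset_UNIV)
  moreover have "Metric_space UNIV (dist :: real \<Rightarrow> _)"
    by (rule Met_TC.Metric_space_axioms)
  ultimately show ?thesis
    by (auto simp: linf_def Metric_space.fspace_def)
qed

lemma mdist_linf:
  assumes "z \<in> mspace (linf F)" "z' \<in> mspace (linf F)" "F \<noteq> {}"
  shows "mdist (linf F) z z' = (SUP f\<in>F. \<bar>z f - z' f\<bar>)"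
  using assms
  by (simp add: linf_def Met_TC.fdist_def dist_real_def)

definition enlargement :: "'f set \<Rightarrow> ('f \<Rightarrow> real) set \<Rightarrow> real \<Rightarrow> ('f \<Rightarrow> real) set" where
  "enlargement F K \<delta> = {z \<in> mspace (linf F). \<exists>z'\<in>K. mdist (linf F) z z' < \<delta>}"


section \<open>Semimetrics\<close>

text \<open>A semimetric satisfies the triangle inequality but need not separate points.\<close>

definition semimetric_on :: "'f set \<Rightarrow> ('f \<Rightarrow> 'f \<Rightarrow> real) \<Rightarrow> bool" where
  "semimetric_on F \<rho> \<longleftrightarrow>
     (\<forall>f\<in>F. \<rho> f f = 0) \<and>
     (\<forall>f\<in>F. \<forall>g\<in>F. 0 \<le> \<rho> f g \<and> \<rho> f g = \<rho> g f) \<and>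
     (\<forall>f\<in>F. \<forall>g\<in>F. \<forall>h\<in>F. \<rho> f h \<le> \<rho> f g + \<rho> g h)"

definition totally_bounded_semimetric :: "'f set \<Rightarrow> ('f \<Rightarrow> 'f \<Rightarrow> real) \<Rightarrow> bool" where
  "totally_bounded_semimetric F \<rho> \<longleftrightarrow>
     (\<forall>\<epsilon>>0. \<exists>T. finite T \<and> T \<subseteq> F \<and> (\<forall>f\<in>F. \<exists>t\<in>T. \<rho> t f < \<epsilon>))"


section \<open>Conditional asymptotic tightness and equicontinuity\<close>

text \<open>
  In what follows \<open>M\<close> is the underlying probability space, \<open>null\<close> is one of the two modes of
  convergence to zero on \<open>M\<close>, and \<open>h N s y x\<close> is the value of the \<open>N\<close>-th mapping where the
  inclusion vector is \<open>s\<close> and the first \<open>N\<close> pairs are given by \<open>y\<close> and \<open>x\<close>.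
  Suprema are taken in \<^typ>\<open>ereal\<close>, so that a supremum over the empty set exceeds no \<open>\<epsilon>\<close>.
\<close>

definition cond_asymp_tight where
  "cond_asymp_tight M null p F h \<longleftrightarrow>
     (\<forall>\<eta>>0. \<exists>K. compactin (mtopology_of (linf F)) K \<and>
        (\<forall>\<delta>>0. \<exists>A. null A \<and>
           (\<forall>N\<ge>1. \<forall>\<omega>\<in>space M.
              P_d p N (\<lambda>s y x. h N s y x \<in> enlargement F K \<delta>) \<omega> + A N \<omega> \<ge> 1 - \<eta>)))"

definition marginals_cond_asymp_tight where
  "marginals_cond_asymp_tight M null p F h \<longleftrightarrow>
     (\<forall>f\<in>F. \<forall>\<eta>>0. \<exists>C>0. \<exists>B. null B \<and>
        (\<forall>N\<ge>1. \<forall>\<omega>\<in>space M.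
           P_d p N (\<lambda>s y x. \<bar>h N s y x f\<bar> \<le> C) \<omega> + B N \<omega> \<ge> 1 - \<eta>))"

definition cond_asymp_equicontinuous where
  "cond_asymp_equicontinuous M null p F h \<rho> \<longleftrightarrow>
     (\<forall>\<epsilon>>0. \<forall>\<eta>>0. \<exists>\<delta>>0. \<exists>C. null C \<and>
        (\<forall>N\<ge>1. \<forall>\<omega>\<in>space M.
           P_d p N (\<lambda>s y x.
             (SUP (f, g)\<in>{(f, g). f \<in> F \<and> g \<in> F \<and> \<rho> f g < \<delta>}.
                ereal \<bar>h N s y x f - h N s y x g\<bar>) > ereal \<epsilon>) \<omega> < \<eta> + C N \<omega>))"

definition cond_asymp_partitionable where
  "cond_asymp_partitionable M null p F h \<longleftrightarrow>
     (\<forall>\<epsilon>>0. \<forall>\<eta>>0. \<exists>\<P>. partition_on F \<P> \<and> finite \<P> \<and> (\<exists>A. null A \<and>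
        (\<forall>N\<ge>1. \<forall>\<omega>\<in>space M.
           P_d p N (\<lambda>s y x.
             (SUP G\<in>\<P>. SUP (f, g)\<in>G \<times> G.
                ereal \<bar>h N s y x f - h N s y x g\<bar>) > ereal \<epsilon>) \<omega> < \<eta> + A N \<omega>)))"

end

theory Submission
  imports Defs
begin

text \<open>
  (i) implies (ii): compact sets \<open>K m\<close> that capture the process up to mass \<open>1 / (m + 1)\<close> induce a
  totally bounded semimetric for which every \<open>K m\<close> is uniformly equicontinuous, and functions close
  to \<open>K m\<close> oscillate little on small balls. (ii) implies (iii): a finite net of \<open>F\<close> yields a partition
  into sets of small diameter. (iii) implies (i): the functions which oscillate by at most \<open>\<epsilon>\<close> on each
  cell and are bounded by \<open>C\<close> at one representative per cell form a closed set with a finite net of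
  radius \<open>4 * \<epsilon>\<close>. Intersecting such sets for \<open>\<epsilon>\<close> tending to 0 and exceptional masses \<open>\<eta> / 2 ^ (m + 1)\<close>
  gives a compact \<open>K\<close>, and every enlargement of \<open>K\<close> already contains one of the finite
  intersections. Hence only finitely many null sequences are ever added up, so the argument does
  not depend on the mode of convergence.
\<close>

section \<open>Decreasing closed sets with finite nets\<close>

context Metric_space
begin

text \<open>Centres may lie anywhere in \<open>M\<close>, while \<open>mtotally_bounded\<close>
  demands centres in \<open>S\<close>. Starting from radius \<open>\<epsilon> / 2\<close>, every
  ball that meets \<open>S\<close> is recentred at a point of \<open>S\<close> inside it, which at
  most doubles the radius.\<close>

lemma mtotally_boundedI:
  assumes "S \<subseteq> M"
    and nets: "\<And>\<epsilon>. 0 < \<epsilon> \<Longrightarrow> \<exists>T. finite T \<and> T \<subseteq> M \<and> S \<subseteq> (\<Union>x\<in>T. mball x \<epsilon>)"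
  shows "mtotally_bounded S"
  unfolding mtotally_bounded_def
proof (intro allI impI)
  fix \<epsilon> :: real assume "0 < \<epsilon>"
  then obtain T where T: "finite T" "S \<subseteq> (\<Union>x\<in>T. mball x (\<epsilon> / 2))"
    using nets[of "\<epsilon> / 2"] by auto
  define c where "c x = (SOME y. y \<in> S \<inter> mball x (\<epsilon> / 2))" for x
  define T' where "T' = {x \<in> T. S \<inter> mball x (\<epsilon> / 2) \<noteq> {}}"
  have c: "c x \<in> S \<inter> mball x (\<epsilon> / 2)" if "x \<in> T'" for x
    using that unfolding T'_def c_def by (metis (mono_tags, lifting) ex_in_conv mem_Collect_eq someI_ex)
  have "S \<subseteq> (\<Union>x\<in>c ` T'. mball x \<epsilon>)"
  proof
    fix y assume "y \<in> S"
    then obtain x where x: "x \<in> T" "y \<in> mball x (\<epsilon> / 2)"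
      using T by auto
    then have x': "x \<in> T'"
      using \<open>y \<in> S\<close> by (auto simp: T'_def)
    have "d (c x) y < \<epsilon>"
      using c[OF x'] x(2) triangle[of "c x" x y] commute[of "c x" x] by auto
    then show "y \<in> (\<Union>x\<in>c ` T'. mball x \<epsilon>)"
      using c[OF x'] x' \<open>y \<in> S\<close> \<open>S \<subseteq> M\<close> by auto
  qed
  moreover have "finite (c ` T')" "c ` T' \<subseteq> S"
    using T(1) c by (auto simp: T'_def)
  ultimately show "\<exists>K. finite K \<and> K \<subseteq> S \<and> S \<subseteq> (\<Union>x\<in>K. mball x \<epsilon>)"
    by blast
qed

text \<open>All but finitely many terms of \<open>\<sigma>\<close> lie in any given
  \<open>U n\<close>, so the nets of the \<open>U n\<close> make the range of
  \<open>\<sigma>\<close> totally bounded. Completeness turns a Cauchy subsequence into a convergent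
  one, and since its tails lie in the closed set \<open>U n\<close>, so does the limit.\<close>

lemma decseq_nets_convergent_subsequence:
  assumes "mcomplete" and "decseq U" and closed: "\<And>n. closedin mtopology (U n)"
    and nets: "\<And>\<epsilon>. 0 < \<epsilon> \<Longrightarrow> \<exists>n T. finite T \<and> T \<subseteq> M \<and> U n \<subseteq> (\<Union>x\<in>T. mball x \<epsilon>)"
    and \<sigma>: "\<And>n. \<sigma> n \<in> U n"
  obtains l r where "l \<in> (\<Inter>n. U n)" "strict_mono r" "limitin mtopology (\<sigma> \<circ> r) l sequentially"
proof -
  have U: "U n \<subseteq> M" for n
    using closed closedin_subset by fastforce
  have "mtotally_bounded (range \<sigma>)"
  proof (rule mtotally_boundedI)
    show "range \<sigma> \<subseteq> M"
      using \<sigma> U by blast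
    fix \<epsilon> :: real assume "0 < \<epsilon>"
    then obtain n T where T: "finite T" "T \<subseteq> M" "U n \<subseteq> (\<Union>x\<in>T. mball x \<epsilon>)"
      using nets[OF \<open>0 < \<epsilon>\<close>] by auto
    \<comment> \<open>The net of \<open>U n\<close> serves the terms from index \<open>n\<close> on;
      the finitely many earlier terms become their own centres.\<close>
    have "\<sigma> i \<in> (\<Union>x\<in>T \<union> \<sigma> ` {..<n}. mball x \<epsilon>)" for i
    proof (cases "i < n")
      case True
      moreover have "\<sigma> i \<in> mball (\<sigma> i) \<epsilon>"
        using \<sigma> U \<open>0 < \<epsilon>\<close> by (meson centre_in_mball_iff subsetD)
      ultimately show ?thesis
        by blast
    next
      case False
      then have "\<sigma> i \<in> U n"
        using \<sigma>[of i] decseqD[OF \<open>decseq U\<close>, of n i] by auto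
      then show ?thesis
        using T by blast
    qed
    then have "range \<sigma> \<subseteq> (\<Union>x\<in>T \<union> \<sigma> ` {..<n}. mball x \<epsilon>)"
      by blast
    moreover have "finite (T \<union> \<sigma> ` {..<n})" "T \<union> \<sigma> ` {..<n} \<subseteq> M"
      using T subsetD[OF U \<sigma>] by auto
    ultimately show "\<exists>T. finite T \<and> T \<subseteq> M \<and> range \<sigma> \<subseteq> (\<Union>x\<in>T. mball x \<epsilon>)"
      by blast
  qed
  then obtain r where r: "strict_mono r" "MCauchy (\<sigma> \<circ> r)"
    unfolding mtotally_bounded_sequentially by blast
  then obtain l where l: "limitin mtopology (\<sigma> \<circ> r) l sequentially"
    using \<open>mcomplete\<close> unfolding mcomplete_def by blast
  have "l \<in> U n" for n
  proof (rule limitin_closedin[OF l closed])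
    have "(\<sigma> \<circ> r) i \<in> U n" if "i \<ge> n" for i
      using \<sigma>[of "r i"] decseqD[OF \<open>decseq U\<close>, of n "r i"] seq_suble[OF r(1), of i] that by auto
    then show "\<forall>\<^sub>F i in sequentially. (\<sigma> \<circ> r) i \<in> U n"
      using eventually_sequentially by blast
  qed auto
  then show ?thesis
    using that r l by blast
qed

text \<open>A sequence in the intersection has its \<open>n\<close>-th term in \<open>U n\<close>,
  so the extraction above yields a convergent subsequence with limit in the intersection.\<close>

lemma compactin_INT_decseq_nets:
  assumes "mcomplete" and "decseq U" and closed: "\<And>n. closedin mtopology (U n)"
    and nets: "\<And>\<epsilon>. 0 < \<epsilon> \<Longrightarrow> \<exists>n T. finite T \<and> T \<subseteq> M \<and> U n \<subseteq> (\<Union>x\<in>T. mball x \<epsilon>)"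
  shows "compactin mtopology (\<Inter>n. U n)"
  unfolding compactin_sequentially
proof (intro conjI allI impI)
  show "(\<Inter>n. U n) \<subseteq> M"
    using closed closedin_subset by fastforce
  fix \<sigma> :: "nat \<Rightarrow> 'a" assume "range \<sigma> \<subseteq> (\<Inter>n. U n)"
  then have "\<And>n. \<sigma> n \<in> U n"
    by auto
  then show "\<exists>l r. l \<in> (\<Inter>n. U n) \<and> strict_mono r \<and> limitin mtopology (\<sigma> \<circ> r) l sequentially"
    using decseq_nets_convergent_subsequence[OF assms] by metis
qed

text \<open>Otherwise each \<open>U n\<close> contains a point \<open>\<sigma> n\<close> at distance
  at least \<open>\<delta>\<close> from the intersection, yet a subsequence of these points
  converges to a point of the intersection. If the intersection is empty, the conclusion says that
  some \<open>U n\<close> is empty.\<close>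

lemma decseq_nets_subset_enlargement:
  assumes "mcomplete" and "decseq U" and closed: "\<And>n. closedin mtopology (U n)"
    and nets: "\<And>\<epsilon>. 0 < \<epsilon> \<Longrightarrow> \<exists>n T. finite T \<and> T \<subseteq> M \<and> U n \<subseteq> (\<Union>x\<in>T. mball x \<epsilon>)"
    and "0 < \<delta>"
  obtains n where "U n \<subseteq> {x \<in> M. \<exists>y\<in>\<Inter>n. U n. d x y < \<delta>}"
proof (rule ccontr)
  assume "\<not> thesis"
  define E where "E = {x \<in> M. \<exists>y\<in>\<Inter>n. U n. d x y < \<delta>}"
  have "\<exists>x. x \<in> U n \<and> x \<notin> E" for n
    using that \<open>\<not> thesis\<close> unfolding E_def by blast
  then obtain \<sigma> where \<sigma>: "\<And>n. \<sigma> n \<in> U n \<and> \<sigma> n \<notin> E"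
    by metis
  then have "\<And>n. \<sigma> n \<in> U n"
    by auto
  then obtain l r where l: "l \<in> (\<Inter>n. U n)" "limitin mtopology (\<sigma> \<circ> r) l sequentially"
    using decseq_nets_convergent_subsequence[OF assms(1-4)] by metis
  then obtain i where "\<sigma> (r i) \<in> M" "d (\<sigma> (r i)) l < \<delta>"
    using \<open>0 < \<delta>\<close> unfolding limit_metric_sequentially by fastforce
  then show False
    using \<sigma>[of "r i"] l(1) unfolding E_def by blast
qed

end

section \<open>Finite nets for finitely many bounded functions\<close>

text \<open>Rounding the values \<open>a i x / \<epsilon>\<close> down to integers leaves finitely
  many patterns \<open>\<phi> x\<close>, and points with the same pattern have values less than
  \<open>\<epsilon>\<close> apart. One representative per pattern forms the net. It is applied both
  to functions evaluated on \<open>F\<close> and, with the roles exchanged, to evaluations on a set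
  of functions.\<close>

lemma finite_net_bounded_family:
  fixes a :: "'i \<Rightarrow> 'x \<Rightarrow> real"
  assumes "finite I" and bounded: "\<And>i. i \<in> I \<Longrightarrow> bounded (a i ` S)" and "0 < \<epsilon>"
  obtains T where "finite T" "T \<subseteq> S" "\<And>x. x \<in> S \<Longrightarrow> \<exists>t\<in>T. \<forall>i\<in>I. \<bar>a i x - a i t\<bar> < \<epsilon>"
proof -
  define \<phi> where "\<phi> x = (\<lambda>i\<in>I. \<lfloor>a i x / \<epsilon>\<rfloor>)" for x
  have "\<exists>B. \<forall>x\<in>S. \<bar>a i x\<bar> \<le> B" if "i \<in> I" for i
    using bounded[OF that] by (auto simp: bounded_iff)
  then obtain B where B: "\<And>i x. i \<in> I \<Longrightarrow> x \<in> S \<Longrightarrow> \<bar>a i x\<bar> \<le> B i"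
    by metis
  have "\<phi> ` S \<subseteq> (\<Pi>\<^sub>E i\<in>I. {\<lfloor>- B i / \<epsilon>\<rfloor>..\<lfloor>B i / \<epsilon>\<rfloor>})"
  proof clarify
    fix x assume "x \<in> S"
    have "\<lfloor>- B i / \<epsilon>\<rfloor> \<le> \<lfloor>a i x / \<epsilon>\<rfloor> \<and> \<lfloor>a i x / \<epsilon>\<rfloor> \<le> \<lfloor>B i / \<epsilon>\<rfloor>" if "i \<in> I" for i
      using B[OF that \<open>x \<in> S\<close>] \<open>0 < \<epsilon>\<close> by (intro conjI floor_mono divide_right_mono) auto
    then show "\<phi> x \<in> (\<Pi>\<^sub>E i\<in>I. {\<lfloor>- B i / \<epsilon>\<rfloor>..\<lfloor>B i / \<epsilon>\<rfloor>})"
      by (auto simp: \<phi>_def)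
  qed
  then have fin: "finite (\<phi> ` S)"
    by (rule finite_subset) (intro finite_PiE \<open>finite I\<close> finite_atLeastAtMost_int)
  show ?thesis
  proof (rule that)
    show "finite (inv_into S \<phi> ` \<phi> ` S)"
      using fin by blast
    show "inv_into S \<phi> ` \<phi> ` S \<subseteq> S"
      by (auto intro: inv_into_into)
    fix x assume "x \<in> S"
    define t where "t = inv_into S \<phi> (\<phi> x)"
    have "\<phi> t = \<phi> x"
      using \<open>x \<in> S\<close> by (simp add: t_def f_inv_into_f)
    have "\<bar>a i x - a i t\<bar> < \<epsilon>" if "i \<in> I" for i
    proof -
      have "\<lfloor>a i t / \<epsilon>\<rfloor> = \<lfloor>a i x / \<epsilon>\<rfloor>"
        using fun_cong[OF \<open>\<phi> t = \<phi> x\<close>, of i] that by (simp add: \<phi>_def)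
      then have "\<bar>a i x / \<epsilon> - a i t / \<epsilon>\<bar> < 1"
        by linarith
      then show ?thesis
        using \<open>0 < \<epsilon>\<close> by (simp add: diff_divide_distrib[symmetric])
    qed
    then show "\<exists>t\<in>inv_into S \<phi> ` \<phi> ` S. \<forall>i\<in>I. \<bar>a i x - a i t\<bar> < \<epsilon>"
      using \<open>x \<in> S\<close> by (auto simp: t_def)
  qed
qed


section \<open>Compact sets of bounded functions\<close>

lemma Metric_space_linf: "Metric_space (mspace (linf F)) (mdist (linf F))"
  by (rule Metric_space_mspace_mdist)

lemma mtopology_of_linf: "mtopology_of (linf F) = Metric_space.mtopology (mspace (linf F)) (mdist (linf F))"
  by (simp add: mtopology_of_def)

lemma mcomplete_linf: "Metric_space.mcomplete (mspace (linf F)) (mdist (linf F))"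
proof -
  have "mcomplete_of (funspace F (Met_TC.Self :: real metric))"
    by (rule Met_TC.mcomplete_funspace) (simp add: mcomplete_iff_complete complete_UNIV)
  then show ?thesis
    by (simp add: linf_def mcomplete_of_def Met_TC.Self_def)
qed

text \<open>The distance is the supremum of the pointwise differences when \<open>F\<close> is
  nonempty; it is 0 when \<open>F\<close> is empty, and there \<open>0 \<le> a\<close>
  decides.\<close>

lemma mdist_linf_le:
  assumes "z \<in> mspace (linf F)" "z' \<in> mspace (linf F)" "0 \<le> a"
    and "\<And>f. f \<in> F \<Longrightarrow> \<bar>z f - z' f\<bar> \<le> a"
  shows "mdist (linf F) z z' \<le> a"
proof (cases "F = {}")
  case True
  then show ?thesis
    using \<open>0 \<le> a\<close> by (simp add: linf_def)
next
  case False
  then show ?thesis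
    using assms by (auto simp: mdist_linf intro: cSUP_least)
qed

lemma abs_diff_le_mdist_linf:
  assumes "z \<in> mspace (linf F)" "z' \<in> mspace (linf F)" "f \<in> F"
  shows "\<bar>z f - z' f\<bar> \<le> mdist (linf F) z z'"
proof -
  have "F \<noteq> {}"
    using \<open>f \<in> F\<close> by auto
  from funspace_mdist_le[OF assms(1,2)[unfolded linf_def] this, of "mdist (linf F) z z'"]
  have "\<forall>f\<in>F. dist (z f) (z' f) \<le> mdist (linf F) z z'"
    unfolding linf_def mdist_euclidean_metric by blast
  then show ?thesis
    using \<open>f \<in> F\<close> by (simp add: dist_real_def)
qed

lemma continuous_map_linf_eval:
  assumes "f \<in> F"
  shows "continuous_map (mtopology_of (linf F)) euclideanreal (\<lambda>z. z f)"
proof -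
  have "Lipschitz_continuous_map (linf F) euclidean_metric (\<lambda>z. z f)"
    unfolding Lipschitz_continuous_map_def
    by (auto simp: dist_real_def assms intro!: exI[of _ 1] abs_diff_le_mdist_linf)
  from Lipschitz_continuous_imp_continuous_map[OF this] show ?thesis
    by simp
qed

text \<open>Evaluation at \<open>f\<close> is continuous, so it maps \<open>K\<close> to a compact,
  hence bounded, set of reals.\<close>

lemma compactin_linf_bounded_eval:
  assumes "compactin (mtopology_of (linf F)) K" "f \<in> F"
  obtains C where "0 < C" "\<And>z. z \<in> K \<Longrightarrow> \<bar>z f\<bar> \<le> C"
proof -
  have "compact ((\<lambda>z. z f) ` K)"
    using image_compactin[OF assms(1) continuous_map_linf_eval[OF assms(2)]] by simp
  then have "bounded ((\<lambda>z. z f) ` K)"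
    by (rule compact_imp_bounded)
  then obtain C where "0 < C" "\<forall>x\<in>(\<lambda>z. z f) ` K. norm x \<le> C"
    unfolding bounded_pos by blast
  then show ?thesis
    by (intro that[of C]) auto
qed

text \<open>The necessity half of the Arzela-Ascoli argument: a net \<open>Z\<close> of
  \<open>K\<close> with radius \<open>\<epsilon> / 3\<close> reduces the claim to finitely many
  bounded functions. Passing from \<open>z\<close> to its neighbour in \<open>Z\<close> at
  \<open>f\<close> and at \<open>t\<close> costs another \<open>\<epsilon> / 3\<close> each.\<close>

lemma compactin_linf_finite_net:
  assumes K: "compactin (mtopology_of (linf F)) K" and "0 < \<epsilon>"
  obtains T where "finite T" "T \<subseteq> F" "\<And>f. f \<in> F \<Longrightarrow> \<exists>t\<in>T. \<forall>z\<in>K. \<bar>z f - z t\<bar> < \<epsilon>"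
proof -
  interpret linf: Metric_space "mspace (linf F)" "mdist (linf F)"
    by (rule Metric_space_linf)
  have "linf.mtotally_bounded K"
    using linf.compactin_imp_mtotally_bounded K by (simp add: mtopology_of_linf)
  then obtain Z where Z: "finite Z" "Z \<subseteq> K" "K \<subseteq> (\<Union>z\<in>Z. linf.mball z (\<epsilon> / 3))"
    unfolding linf.mtotally_bounded_def using \<open>0 < \<epsilon>\<close> by (meson divide_pos_pos zero_less_numeral)
  have Z_sub: "Z \<subseteq> mspace (linf F)"
    using Z(2) compactin_subset_topspace[OF K] by auto
  obtain T where T: "finite T" "T \<subseteq> F" "\<And>f. f \<in> F \<Longrightarrow> \<exists>t\<in>T. \<forall>z\<in>Z. \<bar>z f - z t\<bar> < \<epsilon> / 3"
  proof (rule finite_net_bounded_family[of Z "\<lambda>z f. z f" F "\<epsilon> / 3"])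
    show "bounded ((\<lambda>f. z f) ` F)" if "z \<in> Z" for z
      using that Z_sub mem_linf_iff by auto
  qed (use Z(1) \<open>0 < \<epsilon>\<close> in auto)
  show ?thesis
  proof (rule that[OF T(1,2)])
    fix f assume "f \<in> F"
    then obtain t where t: "t \<in> T" "\<And>z. z \<in> Z \<Longrightarrow> \<bar>z f - z t\<bar> < \<epsilon> / 3"
      using T(3) by blast
    have "\<bar>z f - z t\<bar> < \<epsilon>" if zK: "z \<in> K" for z
    proof -
      obtain w where w: "w \<in> Z" "z \<in> linf.mball w (\<epsilon> / 3)"
        using Z(3) zK by blast
      then have "\<bar>w f - z f\<bar> < \<epsilon> / 3" "\<bar>w t - z t\<bar> < \<epsilon> / 3"
        using abs_diff_le_mdist_linf[of w F z f] abs_diff_le_mdist_linf[of w F z t] \<open>f \<in> F\<close> t(1) T(2)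
        by auto
      then show ?thesis
        using t(2)[OF w(1)] by linarith
    qed
    then show "\<exists>t\<in>T. \<forall>z\<in>K. \<bar>z f - z t\<bar> < \<epsilon>"
      using t(1) by blast
  qed
qed

section \<open>Functions with small oscillation on the cells of a partition\<close>

text \<open>The set \<open>T\<close> is meant to contain a point of every cell, so that the values
  on \<open>T\<close> determine a member up to a small error. Nonstrict inequalities make the set
  closed.\<close>

definition oscillation_bounded :: "'f set \<Rightarrow> 'f set set \<Rightarrow> 'f set \<Rightarrow> real \<Rightarrow> real \<Rightarrow> ('f \<Rightarrow> real) set" where
  "oscillation_bounded F \<P> T \<epsilon> C =
     {z \<in> mspace (linf F). (\<forall>G\<in>\<P>. \<forall>f\<in>G. \<forall>g\<in>G. \<bar>z f - z g\<bar> \<le> \<epsilon>) \<and> (\<forall>t\<in>T. \<bar>z t\<bar> \<le> C)}"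

text \<open>Convergence in \<open>linf F\<close> implies convergence at each point of
  \<open>F\<close>, and the nonstrict inequalities pass to the limit.\<close>

lemma closedin_oscillation_bounded:
  assumes "\<Union>\<P> \<subseteq> F" "T \<subseteq> F"
  shows "closedin (mtopology_of (linf F)) (oscillation_bounded F \<P> T \<epsilon> C)"
proof -
  interpret linf: Metric_space "mspace (linf F)" "mdist (linf F)"
    by (rule Metric_space_linf)
  let ?V = "oscillation_bounded F \<P> T \<epsilon> C"
  have "l \<in> ?V" if \<sigma>: "range \<sigma> \<subseteq> ?V" and l: "limitin linf.mtopology \<sigma> l sequentially" for \<sigma> l
  proof -
    have eval: "(\<lambda>n. \<sigma> n f) \<longlonglongrightarrow> l f" if "f \<in> F" for f
      using continuous_map_limit[OF continuous_map_linf_eval[OF that]] l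
      by (fastforce simp: mtopology_of_linf o_def)
    have "\<bar>l f - l g\<bar> \<le> \<epsilon>" if "G \<in> \<P>" "f \<in> G" "g \<in> G" for G f g
    proof (rule LIMSEQ_le_const2)
      show "(\<lambda>n. \<bar>\<sigma> n f - \<sigma> n g\<bar>) \<longlonglongrightarrow> \<bar>l f - l g\<bar>"
        using that assms(1) by (intro tendsto_intros eval) auto
      have "\<bar>\<sigma> n f - \<sigma> n g\<bar> \<le> \<epsilon>" for n
        using range_subsetD[OF \<sigma>, of n] that by (simp add: oscillation_bounded_def)
      then show "\<exists>N. \<forall>n\<ge>N. \<bar>\<sigma> n f - \<sigma> n g\<bar> \<le> \<epsilon>"
        by blast
    qed
    moreover have "\<bar>l t\<bar> \<le> C" if "t \<in> T" for t
    proof (rule LIMSEQ_le_const2)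
      show "(\<lambda>n. \<bar>\<sigma> n t\<bar>) \<longlonglongrightarrow> \<bar>l t\<bar>"
        using that assms(2) by (intro tendsto_intros eval) auto
      have "\<bar>\<sigma> n t\<bar> \<le> C" for n
        using range_subsetD[OF \<sigma>, of n] that by (simp add: oscillation_bounded_def)
      then show "\<exists>N. \<forall>n\<ge>N. \<bar>\<sigma> n t\<bar> \<le> C"
        by blast
    qed
    moreover have "l \<in> mspace (linf F)"
      using l by (simp add: linf.limitin_metric)
    ultimately show ?thesis
      by (simp add: oscillation_bounded_def)
  qed
  moreover have "?V \<subseteq> mspace (linf F)"
    by (simp add: oscillation_bounded_def)
  ultimately show ?thesis
    unfolding mtopology_of_linf linf.metric_closedin_iff_sequentially_closed by metis
qed

text \<open>On the finite set \<open>T\<close> the members are uniformly bounded, hence have a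
  finite net with error below \<open>\<epsilon>\<close>. Going from \<open>f\<close> to a point of
  \<open>T\<close> in the same cell costs at most \<open>\<epsilon>\<close> for each of the two
  functions.\<close>

lemma oscillation_bounded_finite_net:
  assumes \<P>: "\<Union>\<P> = F" and T: "finite T" "T \<subseteq> F" "\<And>G. G \<in> \<P> \<Longrightarrow> G \<inter> T \<noteq> {}" and "0 < \<epsilon>"
  obtains Z where "finite Z" "Z \<subseteq> mspace (linf F)"
    "oscillation_bounded F \<P> T \<epsilon> C \<subseteq> (\<Union>z\<in>Z. Metric_space.mball (mspace (linf F)) (mdist (linf F)) z (4 * \<epsilon>))"
proof -
  interpret linf: Metric_space "mspace (linf F)" "mdist (linf F)"
    by (rule Metric_space_linf)
  let ?V = "oscillation_bounded F \<P> T \<epsilon> C"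
  have V: "?V \<subseteq> mspace (linf F)"
    by (auto simp: oscillation_bounded_def)
  obtain Z where Z: "finite Z" "Z \<subseteq> ?V" "\<And>z. z \<in> ?V \<Longrightarrow> \<exists>w\<in>Z. \<forall>t\<in>T. \<bar>z t - w t\<bar> < \<epsilon>"
  proof (rule finite_net_bounded_family[of T "\<lambda>t z. z t" ?V \<epsilon>])
    show "bounded ((\<lambda>z. z t) ` ?V)" if "t \<in> T" for t
      using that by (auto simp: oscillation_bounded_def bounded_iff)
  qed (use T(1) \<open>0 < \<epsilon>\<close> in auto)
  have "?V \<subseteq> (\<Union>z\<in>Z. linf.mball z (4 * \<epsilon>))"
  proof
    fix z assume z: "z \<in> ?V"
    then obtain w where w: "w \<in> Z" "\<And>t. t \<in> T \<Longrightarrow> \<bar>z t - w t\<bar> < \<epsilon>"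
      using Z(3) by blast
    then have "w \<in> ?V"
      using Z(2) by blast
    have "\<bar>w f - z f\<bar> \<le> 3 * \<epsilon>" if fF: "f \<in> F" for f
    proof -
      obtain G where G: "G \<in> \<P>" "f \<in> G"
        using fF \<P> by blast
      then obtain t where t: "t \<in> G" "t \<in> T"
        using T(3) by auto
      have "\<bar>z f - z t\<bar> \<le> \<epsilon>" "\<bar>w f - w t\<bar> \<le> \<epsilon>"
        using z \<open>w \<in> ?V\<close> G t(1) by (auto simp: oscillation_bounded_def)
      then show ?thesis
        using w(2)[OF t(2)] by linarith
    qed
    \<comment> \<open>The supremum is bounded by \<open>3 * \<epsilon>\<close> without strictness;
      radius \<open>4 * \<epsilon>\<close> leaves room for an open ball.\<close>
    then have "mdist (linf F) w z \<le> 3 * \<epsilon>"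
      using z \<open>w \<in> ?V\<close> V \<open>0 < \<epsilon>\<close> by (intro mdist_linf_le) auto
    then have "z \<in> linf.mball w (4 * \<epsilon>)"
      using z \<open>w \<in> ?V\<close> V \<open>0 < \<epsilon>\<close> by auto
    then show "z \<in> (\<Union>z\<in>Z. linf.mball z (4 * \<epsilon>))"
      using w(1) by blast
  qed
  then show ?thesis
    using that Z(1,2) V by blast
qed

section \<open>A semimetric built from countably many compact sets\<close>

text \<open>
  The semimetric is the supremum of \<open>\<bar>z f - z g\<bar>\<close> over all \<open>z\<close> in all \<open>K m\<close>, truncated at
  \<open>1 / (m + 1)\<close>: at any given scale only finitely many of the compact sets matter, which gives
  total boundedness.
\<close>

lemma semimetric_of_compacts:
  assumes K: "\<And>m::nat. compactin (mtopology_of (linf F)) (K m)"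
  shows "\<exists>\<rho>. semimetric_on F \<rho> \<and> totally_bounded_semimetric F \<rho> \<and>
    (\<forall>m. \<forall>\<epsilon>>0. \<exists>\<delta>>0. \<forall>f\<in>F. \<forall>g\<in>F. \<rho> f g < \<delta> \<longrightarrow> (\<forall>z\<in>K m. \<bar>z f - z g\<bar> < \<epsilon>))"
proof -
  \<comment> \<open>The zero function keeps the index set of the supremum nonempty even if all \<open>K m\<close> are empty.\<close>
  define J where "J = insert (0, \<lambda>_. 0) (Sigma UNIV K)"
  define a :: "nat \<times> ('a \<Rightarrow> real) \<Rightarrow> 'a \<Rightarrow> 'a \<Rightarrow> real"
    where "a = (\<lambda>(m, z) f g. min (inverse (real (Suc m))) \<bar>z f - z g\<bar>)"
  define \<rho> where "\<rho> f g = (SUP j\<in>J. a j f g)" for f g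
  \<comment> \<open>The uniform bound 1 makes the real supremum that defines \<open>\<rho>\<close>
    an actual upper bound of its terms.\<close>
  have "a j f g \<le> 1" for j f g
    by (cases j) (auto simp: a_def min_le_iff_disj inverse_le_1_iff)
  then have a_le: "a j f g \<le> \<rho> f g" if "j \<in> J" for j f g
    unfolding \<rho>_def using that by (intro cSUP_upper bdd_aboveI2[where M = 1]) auto
  have \<rho>_le: "\<rho> f g \<le> c" if "\<And>j. j \<in> J \<Longrightarrow> a j f g \<le> c" for f g c
    unfolding \<rho>_def by (rule cSUP_least) (use that in \<open>auto simp: J_def\<close>)
  \<comment> \<open>Truncation at a positive level preserves the triangle inequality.\<close>
  have a_triangle: "a j f h \<le> a j f g + a j g h" for j f g h
  proof -
    obtain m z where "j = (m, z)"
      by (cases j)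
    moreover have "\<bar>z f - z h\<bar> \<le> \<bar>z f - z g\<bar> + \<bar>z g - z h\<bar>" "0 < inverse (real (Suc m))"
      by auto
    ultimately show ?thesis
      unfolding a_def by (auto simp: min_def simp del: of_nat_Suc)
  qed
  have a_refl: "a j f f = 0" and a_sym: "a j f g = a j g f" for j f g
    by (cases j; simp add: a_def abs_minus_commute)+
  have "0 \<le> \<rho> f g" for f g
    using a_le[of "(0, \<lambda>_. 0)" f g] by (simp add: J_def a_def)
  moreover have "\<rho> f f = 0" for f
    using \<rho>_le[of f f 0] \<open>0 \<le> \<rho> f f\<close> by (simp add: a_refl)
  moreover have "\<rho> f g = \<rho> g f" for f g
    unfolding \<rho>_def by (simp add: a_sym[of _ f g])
  moreover have "\<rho> f h \<le> \<rho> f g + \<rho> g h" for f g h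
    by (rule \<rho>_le) (rule order_trans[OF a_triangle add_mono[OF a_le a_le]])
  ultimately have "semimetric_on F \<rho>"
    unfolding semimetric_on_def by blast
  moreover have "totally_bounded_semimetric F \<rho>"
    unfolding totally_bounded_semimetric_def
  proof (intro allI impI)
    fix \<epsilon> :: real assume "0 < \<epsilon>"
    obtain m0 where m0: "inverse (real (Suc m0)) < \<epsilon> / 2"
      using reals_Archimedean[of "\<epsilon> / 2"] \<open>0 < \<epsilon>\<close> by auto
    \<comment> \<open>For \<open>m > m0\<close> the truncation alone keeps the terms below
      \<open>\<epsilon> / 2\<close>, so one net for the finite union of the remaining compact sets
      suffices.\<close>
    have "compactin (mtopology_of (linf F)) (\<Union>m\<le>m0. K m)"
      using K by (auto intro!: compactin_Union)
    then obtain T where T: "finite T" "T \<subseteq> F"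
      "\<And>f. f \<in> F \<Longrightarrow> \<exists>t\<in>T. \<forall>z\<in>\<Union>m\<le>m0. K m. \<bar>z f - z t\<bar> < \<epsilon> / 2"
      by (rule compactin_linf_finite_net[of _ _ "\<epsilon> / 2"]) (use \<open>0 < \<epsilon>\<close> in auto)
    have "\<exists>t\<in>T. \<rho> t f < \<epsilon>" if "f \<in> F" for f
    proof -
      obtain t where t: "t \<in> T" "\<forall>z\<in>\<Union>m\<le>m0. K m. \<bar>z f - z t\<bar> < \<epsilon> / 2"
        using T(3)[OF \<open>f \<in> F\<close>] by blast
      have "\<rho> t f \<le> \<epsilon> / 2"
      proof (rule \<rho>_le)
        fix j assume "j \<in> J"
        then consider "j = (0, \<lambda>_. 0)" | m z where "j = (m, z)" "z \<in> K m"
          by (auto simp: J_def)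
        then show "a j t f \<le> \<epsilon> / 2"
        proof cases
          case 1
          then show ?thesis
            using \<open>0 < \<epsilon>\<close> by (simp add: a_def)
        next
          case 2
          show ?thesis
          proof (cases "m \<le> m0")
            case True
            then have "\<bar>z f - z t\<bar> < \<epsilon> / 2"
              using t(2) 2 by auto
            then show ?thesis
              unfolding 2 a_def prod.case abs_minus_commute[of "z t"] by (intro min.coboundedI2) simp
          next
            case False
            then have "inverse (real (Suc m)) \<le> inverse (real (Suc m0))"
              by (intro le_imp_inverse_le) auto
            then show ?thesis
              using m0 unfolding 2 a_def prod.case by (intro min.coboundedI1) linarith
          qed
        qed
      qed
      then show ?thesis
        using t(1) \<open>0 < \<epsilon>\<close> by (intro bexI[of _ t]) auto
    qed
    then show "\<exists>T. finite T \<and> T \<subseteq> F \<and> (\<forall>f\<in>F. \<exists>t\<in>T. \<rho> t f < \<epsilon>)"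
      using T(1,2) by blast
  qed
  \<comment> \<open>With \<open>\<delta>\<close> at most the truncation level of \<open>K m\<close>,
    the relation \<open>\<rho> f g < \<delta>\<close> forces the minimum in \<open>a\<close> to be
    \<open>\<bar>z f - z g\<bar>\<close> itself.\<close>
  moreover have "\<exists>\<delta>>0. \<forall>f\<in>F. \<forall>g\<in>F. \<rho> f g < \<delta> \<longrightarrow> (\<forall>z\<in>K m. \<bar>z f - z g\<bar> < \<epsilon>)"
    if "0 < \<epsilon>" for m \<epsilon>
  proof (intro exI[of _ "min (inverse (real (Suc m))) \<epsilon>"] conjI ballI impI)
    show "0 < min (inverse (real (Suc m))) \<epsilon>"
      using that by simp
    fix f g z assume \<rho>: "\<rho> f g < min (inverse (real (Suc m))) \<epsilon>" and "z \<in> K m"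
    then have "a (m, z) f g < min (inverse (real (Suc m))) \<epsilon>"
      using a_le[of "(m, z)" f g] by (simp add: J_def)
    then show "\<bar>z f - z g\<bar> < \<epsilon>"
      unfolding a_def by (auto simp: min_def simp del: of_nat_Suc split: if_splits)
  qed
  ultimately show ?thesis
    by blast
qed

section \<open>Conditional tightness for an arbitrary mode of convergence\<close>

text \<open>If the sum exceeds \<open>\<epsilon>\<close> in absolute value, one summand exceeds
  \<open>\<epsilon> / 2\<close>; both of these events have vanishing probability.\<close>

lemma null_in_probability_add:
  assumes "finite_measure M" and A: "null_in_probability M A" and B: "null_in_probability M B"
  shows "null_in_probability M (\<lambda>N \<omega>. A N \<omega> + B N \<omega>)"
proof -
  interpret finite_measure M by fact
  have meas [measurable]: "\<And>N. A N \<in> borel_measurable M" "\<And>N. B N \<in> borel_measurable M"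
    using A B by (simp_all add: null_in_probability_def)
  have "(\<lambda>N. measure M {\<omega>\<in>space M. \<bar>A N \<omega> + B N \<omega>\<bar> > \<epsilon>}) \<longlonglongrightarrow> 0" if "0 < \<epsilon>" for \<epsilon>
  proof (rule tendsto_sandwich[OF _ _ tendsto_const])
    let ?a = "\<lambda>N. measure M {\<omega>\<in>space M. \<bar>A N \<omega>\<bar> > \<epsilon> / 2}"
    let ?b = "\<lambda>N. measure M {\<omega>\<in>space M. \<bar>B N \<omega>\<bar> > \<epsilon> / 2}"
    have "measure M {\<omega>\<in>space M. \<bar>A N \<omega> + B N \<omega>\<bar> > \<epsilon>} \<le> ?a N + ?b N" for N
    proof -
      have "measure M {\<omega>\<in>space M. \<bar>A N \<omega> + B N \<omega>\<bar> > \<epsilon>}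
          \<le> measure M ({\<omega>\<in>space M. \<bar>A N \<omega>\<bar> > \<epsilon> / 2} \<union> {\<omega>\<in>space M. \<bar>B N \<omega>\<bar> > \<epsilon> / 2})"
        by (rule finite_measure_mono) auto
      also have "\<dots> \<le> ?a N + ?b N"
        by (rule measure_subadditive) (auto simp: fmeasurable_eq_sets)
      finally show ?thesis .
    qed
    then show "\<forall>\<^sub>F N in sequentially. measure M {\<omega>\<in>space M. \<bar>A N \<omega> + B N \<omega>\<bar> > \<epsilon>} \<le> ?a N + ?b N"
      by simp
    have "?a \<longlonglongrightarrow> 0" "?b \<longlonglongrightarrow> 0"
      using A B half_gt_zero[OF that] unfolding null_in_probability_def by blast+
    from tendsto_add[OF this] show "(\<lambda>N. ?a N + ?b N) \<longlonglongrightarrow> 0"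
      by simp
  qed simp
  then show ?thesis
    by (simp add: null_in_probability_def)
qed

lemma null_almost_surely_add:
  assumes A: "null_almost_surely M A" and B: "null_almost_surely M B"
  shows "null_almost_surely M (\<lambda>N \<omega>. A N \<omega> + B N \<omega>)"
proof -
  have "AE \<omega> in M. (\<lambda>N. A N \<omega>) \<longlonglongrightarrow> 0" "AE \<omega> in M. (\<lambda>N. B N \<omega>) \<longlonglongrightarrow> 0"
    using A B by (simp_all add: null_almost_surely_def)
  then have "AE \<omega> in M. (\<lambda>N. A N \<omega> + B N \<omega>) \<longlonglongrightarrow> 0"
    by eventually_elim (use tendsto_add in fastforce)
  then show ?thesis
    using A B unfolding null_almost_surely_def by (intro conjI allI borel_measurable_add) blast+
qed

text \<open>
  The assumption \<open>h_in_linf\<close> is restricted to vectors of positive probability because only those are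
  attained by \<open>Svec\<close>; elsewhere \<open>h\<close> is arbitrary.
\<close>

locale conditional_design =
  fixes M :: "((nat \<Rightarrow> 'y \<times> 'x) \<times> 'd) measure"
    and null :: "(nat \<Rightarrow> (nat \<Rightarrow> 'y \<times> 'x) \<times> 'd \<Rightarrow> real) \<Rightarrow> bool"
    and p :: "nat \<Rightarrow> (nat \<Rightarrow> nat) \<Rightarrow> (nat \<Rightarrow> 'x) \<Rightarrow> real"
    and F :: "'f set"
    and h :: "nat \<Rightarrow> (nat \<Rightarrow> nat) \<Rightarrow> (nat \<Rightarrow> 'y) \<Rightarrow> (nat \<Rightarrow> 'x) \<Rightarrow> 'f \<Rightarrow> real"
  assumes p_nonneg: "\<And>N \<omega> s. N \<ge> 1 \<Longrightarrow> \<omega> \<in> space M \<Longrightarrow> s \<in> binvecs N \<Longrightarrow> 0 \<le> p N s (Xvec N \<omega>)"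
    and p_sum: "\<And>N \<omega>. N \<ge> 1 \<Longrightarrow> \<omega> \<in> space M \<Longrightarrow> (\<Sum>s\<in>binvecs N. p N s (Xvec N \<omega>)) = 1"
    and h_in_linf: "\<And>N \<omega> s. N \<ge> 1 \<Longrightarrow> \<omega> \<in> space M \<Longrightarrow> s \<in> binvecs N \<Longrightarrow> 0 < p N s (Xvec N \<omega>) \<Longrightarrow>
      h N s (Yvec N \<omega>) (Xvec N \<omega>) \<in> mspace (linf F)"
    and null_0: "null (\<lambda>N \<omega>. 0)"
    and null_add: "\<And>A B. null A \<Longrightarrow> null B \<Longrightarrow> null (\<lambda>N \<omega>. A N \<omega> + B N \<omega>)"
begin

section \<open>Calculus of null sequences and design probabilities\<close>

lemma null_sum:
  assumes "finite I" "\<And>i. i \<in> I \<Longrightarrow> null (A i)"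
  shows "null (\<lambda>N \<omega>. \<Sum>i\<in>I. A i N \<omega>)"
  using assms by (induction I rule: finite_induct) (simp_all add: null_0 null_add)

text \<open>The union bound holds summand by summand in the finite sum over selection vectors. The
  inclusion of events is required only where \<open>h\<close> takes a value in
  \<open>linf F\<close>, because all other summands have weight 0.\<close>

lemma P_d_UN_le:
  assumes N: "N \<ge> 1" "\<omega> \<in> space M" and "finite I"
    and sub: "\<And>s y x. h N s y x \<in> mspace (linf F) \<Longrightarrow> E s y x \<Longrightarrow> \<exists>i\<in>I. E' i s y x"
  shows "P_d p N E \<omega> \<le> (\<Sum>i\<in>I. P_d p N (E' i) \<omega>)"
proof -
  let ?y = "Yvec N \<omega>" and ?x = "Xvec N \<omega>"
  have "of_bool (E s ?y ?x) * p N s ?x \<le> (\<Sum>i\<in>I. of_bool (E' i s ?y ?x) * p N s ?x)"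
    if s: "s \<in> binvecs N" for s
  proof (cases "E s ?y ?x \<and> 0 < p N s ?x")
    case True
    then obtain i where i: "i \<in> I" "E' i s ?y ?x"
      using sub h_in_linf[OF N s] by blast
    have "of_bool (E' i s ?y ?x) * p N s ?x \<le> (\<Sum>i\<in>I. of_bool (E' i s ?y ?x) * p N s ?x)"
      using p_nonneg[OF N s] \<open>finite I\<close> i(1) by (intro member_le_sum) auto
    then show ?thesis
      using True i by simp
  next
    case False
    then have "of_bool (E s ?y ?x) * p N s ?x = 0"
      using p_nonneg[OF N s] by auto
    moreover have "0 \<le> (\<Sum>i\<in>I. of_bool (E' i s ?y ?x) * p N s ?x)"
      using p_nonneg[OF N s] by (intro sum_nonneg) auto
    ultimately show ?thesis
      by linarith
  qed
  then have "P_d p N E \<omega> \<le> (\<Sum>s\<in>binvecs N. \<Sum>i\<in>I. of_bool (E' i s ?y ?x) * p N s ?x)"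
    unfolding P_d_def E_d_def by (rule sum_mono)
  also have "\<dots> = (\<Sum>i\<in>I. P_d p N (E' i) \<omega>)"
    unfolding P_d_def E_d_def by (rule sum.swap)
  finally show ?thesis .
qed

lemma P_d_mono:
  assumes "N \<ge> 1" "\<omega> \<in> space M"
    and "\<And>s y x. h N s y x \<in> mspace (linf F) \<Longrightarrow> E s y x \<Longrightarrow> E' s y x"
  shows "P_d p N E \<omega> \<le> P_d p N E' \<omega>"
  using P_d_UN_le[of N \<omega> "{()}" E "\<lambda>_. E'"] assms by simp

lemma P_d_Un_le:
  assumes "N \<ge> 1" "\<omega> \<in> space M"
    and "\<And>s y x. h N s y x \<in> mspace (linf F) \<Longrightarrow> E s y x \<Longrightarrow> E1 s y x \<or> E2 s y x"
  shows "P_d p N E \<omega> \<le> P_d p N E1 \<omega> + P_d p N E2 \<omega>"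
proof -
  have "P_d p N E \<omega> \<le> (\<Sum>E'\<in>{True, False}. P_d p N (if E' then E1 else E2) \<omega>)"
    using assms(3) by (intro P_d_UN_le assms(1,2)) auto
  then show ?thesis
    by simp
qed

text \<open>The weights sum to 1. This converts the lower bounds of the tightness conditions into
  upper bounds for exceptional events.\<close>

lemma P_d_not:
  assumes "N \<ge> 1" "\<omega> \<in> space M"
  shows "P_d p N (\<lambda>s y x. \<not> E s y x) \<omega> = 1 - P_d p N E \<omega>"
  unfolding P_d_def E_d_def p_sum[OF assms, symmetric] sum_subtractf[symmetric]
  by (rule sum.cong) auto

section \<open>From tightness to marginals and equicontinuity\<close>

text \<open>The compact set is bounded at \<open>f\<close> by some \<open>C\<close>, so its
  enlargement by 1 is bounded there by \<open>C + 1\<close>; the single choice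
  \<open>\<delta> = 1\<close> therefore suffices.\<close>

lemma tight_imp_marginals:
  assumes "cond_asymp_tight M null p F h"
  shows "marginals_cond_asymp_tight M null p F h"
  unfolding marginals_cond_asymp_tight_def
proof (intro ballI allI impI)
  fix f and \<eta> :: real assume "f \<in> F" "0 < \<eta>"
  then obtain K where K: "compactin (mtopology_of (linf F)) K"
    and *: "\<And>\<delta>. \<delta> > 0 \<Longrightarrow> \<exists>A. null A \<and> (\<forall>N\<ge>1. \<forall>\<omega>\<in>space M.
      P_d p N (\<lambda>s y x. h N s y x \<in> enlargement F K \<delta>) \<omega> + A N \<omega> \<ge> 1 - \<eta>)"
    using assms unfolding cond_asymp_tight_def by blast
  obtain A where A: "null A" "\<And>N \<omega>. N \<ge> 1 \<Longrightarrow> \<omega> \<in> space M \<Longrightarrow>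
      P_d p N (\<lambda>s y x. h N s y x \<in> enlargement F K 1) \<omega> + A N \<omega> \<ge> 1 - \<eta>"
    using *[of 1] by auto
  obtain C where C: "0 < C" "\<And>z. z \<in> K \<Longrightarrow> \<bar>z f\<bar> \<le> C"
    using compactin_linf_bounded_eval[OF K \<open>f \<in> F\<close>] by blast
  have "\<bar>z f\<bar> \<le> C + 1" if z: "z \<in> enlargement F K 1" for z
  proof -
    obtain w where w: "w \<in> K" "mdist (linf F) z w < 1" "z \<in> mspace (linf F)"
      using z by (auto simp: enlargement_def)
    moreover have "w \<in> mspace (linf F)"
      using w(1) compactin_subset_topspace[OF K] by auto
    ultimately have "\<bar>z f - w f\<bar> < 1"
      using abs_diff_le_mdist_linf[of z F w f] \<open>f \<in> F\<close> by linarith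
    then show ?thesis
      using C(2)[OF w(1)] by linarith
  qed
  then have "P_d p N (\<lambda>s y x. h N s y x \<in> enlargement F K 1) \<omega> \<le> P_d p N (\<lambda>s y x. \<bar>h N s y x f\<bar> \<le> C + 1) \<omega>"
    if "N \<ge> 1" "\<omega> \<in> space M" for N \<omega>
    using that by (intro P_d_mono) auto
  then have "\<forall>N\<ge>1. \<forall>\<omega>\<in>space M. P_d p N (\<lambda>s y x. \<bar>h N s y x f\<bar> \<le> C + 1) \<omega> + A N \<omega> \<ge> 1 - \<eta>"
    using A(2) by (meson add_right_mono order_trans)
  then show "\<exists>C>0. \<exists>B. null B \<and>
      (\<forall>N\<ge>1. \<forall>\<omega>\<in>space M. P_d p N (\<lambda>s y x. \<bar>h N s y x f\<bar> \<le> C) \<omega> + B N \<omega> \<ge> 1 - \<eta>)"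
    using A(1) C(1) by (intro exI[of _ "C + 1"]) auto
qed

text \<open>The semimetric is built from all \<open>K m\<close> before \<open>\<epsilon>\<close> and
  \<open>\<eta>\<close> are given. A function within \<open>\<epsilon> / 3\<close> of a member of
  \<open>K m\<close> inherits its oscillation bound \<open>\<epsilon> / 3\<close> with total error
  below \<open>\<epsilon>\<close>.\<close>

lemma tight_imp_equicontinuous:
  assumes "cond_asymp_tight M null p F h"
  obtains \<rho> where "semimetric_on F \<rho>" "totally_bounded_semimetric F \<rho>"
    "cond_asymp_equicontinuous M null p F h \<rho>"
proof -
  have "\<exists>K. compactin (mtopology_of (linf F)) K \<and>
      (\<forall>\<delta>>0. \<exists>A. null A \<and> (\<forall>N\<ge>1. \<forall>\<omega>\<in>space M.
        P_d p N (\<lambda>s y x. h N s y x \<in> enlargement F K \<delta>) \<omega> + A N \<omega> \<ge> 1 - inverse (real (Suc m))))" for m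
    using assms unfolding cond_asymp_tight_def by simp
  then obtain K where K: "\<And>m. compactin (mtopology_of (linf F)) (K m)"
    and tight: "\<And>m \<delta>. \<delta> > 0 \<Longrightarrow> \<exists>A. null A \<and> (\<forall>N\<ge>1. \<forall>\<omega>\<in>space M.
        P_d p N (\<lambda>s y x. h N s y x \<in> enlargement F (K m) \<delta>) \<omega> + A N \<omega> \<ge> 1 - inverse (real (Suc m)))"
    by metis
  obtain \<rho> where \<rho>: "semimetric_on F \<rho>" "totally_bounded_semimetric F \<rho>"
    and unif: "\<And>m \<epsilon>. 0 < \<epsilon> \<Longrightarrow> \<exists>\<delta>>0. \<forall>f\<in>F. \<forall>g\<in>F. \<rho> f g < \<delta> \<longrightarrow> (\<forall>z\<in>K m. \<bar>z f - z g\<bar> < \<epsilon>)"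
    using semimetric_of_compacts[of F K, OF K] by auto
  have "cond_asymp_equicontinuous M null p F h \<rho>"
    unfolding cond_asymp_equicontinuous_def
  proof (intro allI impI)
    fix \<epsilon> \<eta> :: real assume "0 < \<epsilon>" "0 < \<eta>"
    \<comment> \<open>The strict inequality here supplies the strict bound by
      \<open>\<eta> + A N \<omega>\<close> at the end.\<close>
    then obtain m where m: "inverse (real (Suc m)) < \<eta>"
      using reals_Archimedean by blast
    obtain \<delta> where \<delta>: "\<delta> > 0"
      "\<And>f g z. f \<in> F \<Longrightarrow> g \<in> F \<Longrightarrow> \<rho> f g < \<delta> \<Longrightarrow> z \<in> K m \<Longrightarrow> \<bar>z f - z g\<bar> < \<epsilon> / 3"
      using unif[of "\<epsilon> / 3" m] \<open>0 < \<epsilon>\<close> by auto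
    obtain A where A: "null A" "\<And>N \<omega>. N \<ge> 1 \<Longrightarrow> \<omega> \<in> space M \<Longrightarrow>
        P_d p N (\<lambda>s y x. h N s y x \<in> enlargement F (K m) (\<epsilon> / 3)) \<omega> + A N \<omega> \<ge> 1 - inverse (real (Suc m))"
      using tight[of "\<epsilon> / 3" m] \<open>0 < \<epsilon>\<close> by auto
    let ?E = "\<lambda>N s y x. (SUP (f, g)\<in>{(f, g). f \<in> F \<and> g \<in> F \<and> \<rho> f g < \<delta>}.
                ereal \<bar>h N s y x f - h N s y x g\<bar>) > ereal \<epsilon>"
    have close: "\<bar>z f - z g\<bar> < \<epsilon>"
      if z: "z \<in> enlargement F (K m) (\<epsilon> / 3)" and fg: "f \<in> F" "g \<in> F" "\<rho> f g < \<delta>" for z f g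
    proof -
      obtain w where w: "w \<in> K m" "mdist (linf F) z w < \<epsilon> / 3" "z \<in> mspace (linf F)"
        using z by (auto simp: enlargement_def)
      moreover have "w \<in> mspace (linf F)"
        using w(1) compactin_subset_topspace[OF K[of m]] by auto
      ultimately have "\<bar>z f - w f\<bar> < \<epsilon> / 3" "\<bar>z g - w g\<bar> < \<epsilon> / 3"
        using abs_diff_le_mdist_linf[of z F w] fg by (meson le_less_trans)+
      then show ?thesis
        using \<delta>(2)[OF fg w(1)] by linarith
    qed
    have "P_d p N (?E N) \<omega> < \<eta> + A N \<omega>" if N: "N \<ge> 1" "\<omega> \<in> space M" for N \<omega>
    proof -
      \<comment> \<open>A supremum above \<open>\<epsilon>\<close> is witnessed by a single pair,
        which \<open>close\<close> excludes on the enlargement.\<close>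
      have "P_d p N (?E N) \<omega> \<le> P_d p N (\<lambda>s y x. \<not> h N s y x \<in> enlargement F (K m) (\<epsilon> / 3)) \<omega>"
        using close by (intro P_d_mono N) (fastforce simp: less_SUP_iff)
      also have "\<dots> \<le> inverse (real (Suc m)) + A N \<omega>"
        using A(2)[OF N] by (simp only: P_d_not[OF N])
      finally show ?thesis
        using m by linarith
    qed
    then show "\<exists>\<delta>>0. \<exists>C. null C \<and> (\<forall>N\<ge>1. \<forall>\<omega>\<in>space M.
        P_d p N (\<lambda>s y x. (SUP (f, g)\<in>{(f, g). f \<in> F \<and> g \<in> F \<and> \<rho> f g < \<delta>}.
          ereal \<bar>h N s y x f - h N s y x g\<bar>) > ereal \<epsilon>) \<omega> < \<eta> + C N \<omega>)"
      using \<delta>(1) A(1) by blast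
  qed
  then show ?thesis
    using that \<rho> by blast
qed

section \<open>From equicontinuity to finite partitions\<close>

text \<open>Each \<open>f\<close> is sent to a net point \<open>c f\<close> closer than
  \<open>\<delta> / 2\<close>. Two elements of the same fibre of \<open>c\<close> are then closer
  than \<open>\<delta>\<close>, so an oscillation above \<open>\<epsilon>\<close> on a cell is one
  of the oscillations that equicontinuity controls.\<close>

lemma equicontinuous_imp_partitionable:
  assumes \<rho>: "semimetric_on F \<rho>" "totally_bounded_semimetric F \<rho>"
    and equi: "cond_asymp_equicontinuous M null p F h \<rho>"
  shows "cond_asymp_partitionable M null p F h"
  unfolding cond_asymp_partitionable_def
proof (intro allI impI)
  fix \<epsilon> \<eta> :: real assume "0 < \<epsilon>" "0 < \<eta>"
  let ?E = "\<lambda>\<delta> N s y x. (SUP (f, g)\<in>{(f, g). f \<in> F \<and> g \<in> F \<and> \<rho> f g < \<delta>}.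
              ereal \<bar>h N s y x f - h N s y x g\<bar>) > ereal \<epsilon>"
  have "\<exists>\<delta>>0. \<exists>C. null C \<and> (\<forall>N\<ge>1. \<forall>\<omega>\<in>space M. P_d p N (?E \<delta> N) \<omega> < \<eta> + C N \<omega>)"
    using equi \<open>0 < \<epsilon>\<close> \<open>0 < \<eta>\<close> by (simp add: cond_asymp_equicontinuous_def)
  then obtain \<delta> C where \<delta>: "\<delta> > 0" and C: "null C"
    "\<And>N \<omega>. N \<ge> 1 \<Longrightarrow> \<omega> \<in> space M \<Longrightarrow> P_d p N (?E \<delta> N) \<omega> < \<eta> + C N \<omega>"
    by blast
  obtain T where T: "finite T" "T \<subseteq> F" "\<And>f. f \<in> F \<Longrightarrow> \<exists>t\<in>T. \<rho> t f < \<delta> / 2"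
    using \<rho>(2) \<delta> unfolding totally_bounded_semimetric_def by (meson half_gt_zero)
  then obtain c where c: "\<And>f. f \<in> F \<Longrightarrow> c f \<in> T" "\<And>f. f \<in> F \<Longrightarrow> \<rho> (c f) f < \<delta> / 2"
    by metis
  \<comment> \<open>Net points that attract no element give empty fibres, which a partition may not
    contain.\<close>
  define \<P> where "\<P> = (\<lambda>t. {f \<in> F. c f = t}) ` T - {{}}"
  have "partition_on F \<P>"
    using c(1) by (intro partition_onI) (auto simp: \<P>_def disjnt_def)
  moreover have "finite \<P>"
    using T(1) by (simp add: \<P>_def)
  moreover have "P_d p N (\<lambda>s y x. (SUP G\<in>\<P>. SUP (f, g)\<in>G \<times> G.
      ereal \<bar>h N s y x f - h N s y x g\<bar>) > ereal \<epsilon>) \<omega> < \<eta> + C N \<omega>" if N: "N \<ge> 1" "\<omega> \<in> space M" for N \<omega>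
  proof (rule le_less_trans[OF _ C(2)[OF N]], rule P_d_mono[OF N])
    fix s y x
    assume "(SUP G\<in>\<P>. SUP (f, g)\<in>G \<times> G. ereal \<bar>h N s y x f - h N s y x g\<bar>) > ereal \<epsilon>"
    then obtain G f g where G: "G \<in> \<P>" "f \<in> G" "g \<in> G" and gt: "ereal \<bar>h N s y x f - h N s y x g\<bar> > ereal \<epsilon>"
      by (fastforce simp: less_SUP_iff)
    then have fg: "f \<in> F" "g \<in> F" "c f = c g"
      by (auto simp: \<P>_def)
    moreover have "c f \<in> F"
      using c(1) T(2) fg(1) by blast
    moreover have "\<rho> f g \<le> \<rho> f (c f) + \<rho> (c f) g" "\<rho> f (c f) = \<rho> (c f) f"
      using \<rho>(1) fg(1,2) \<open>c f \<in> F\<close> unfolding semimetric_on_def by blast+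
    ultimately have "\<rho> f g < \<delta>"
      using c(2)[OF fg(1)] c(2)[OF fg(2)] by simp
    then show "?E \<delta> N s y x"
      using fg gt unfolding less_SUP_iff by (intro bexI[of _ "(f, g)"]) auto
  qed
  ultimately show "\<exists>\<P>. partition_on F \<P> \<and> finite \<P> \<and> (\<exists>A. null A \<and> (\<forall>N\<ge>1. \<forall>\<omega>\<in>space M.
      P_d p N (\<lambda>s y x. (SUP G\<in>\<P>. SUP (f, g)\<in>G \<times> G.
        ereal \<bar>h N s y x f - h N s y x g\<bar>) > ereal \<epsilon>) \<omega> < \<eta> + A N \<omega>))"
    using C(1) by blast
qed

section \<open>From finite partitions back to tightness\<close>

text \<open>Induction on \<open>T\<close>: half of \<open>\<eta>\<close> goes to the new point and
  half to the old ones, the bounds combine by \<open>max\<close>, and the null sequences add up.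
  Hence \<open>\<eta>\<close> is generalised.\<close>

lemma marginals_finite_bound:
  assumes marg: "marginals_cond_asymp_tight M null p F h" and "finite T" "T \<subseteq> F" "0 < \<eta>"
  shows "\<exists>C B. null B \<and> (\<forall>N\<ge>1. \<forall>\<omega>\<in>space M. P_d p N (\<lambda>s y x. \<exists>t\<in>T. \<bar>h N s y x t\<bar> > C) \<omega> \<le> \<eta> + B N \<omega>)"
  using assms(2-)
proof (induction T arbitrary: \<eta> rule: finite_induct)
  case empty
  then show ?case
    using null_0 by (intro exI[of _ 0] exI[of _ "\<lambda>_ _. 0"]) (simp add: P_d_def E_d_def)
next
  case (insert t T)
  then obtain C B where CB: "null B" "\<And>N \<omega>. N \<ge> 1 \<Longrightarrow> \<omega> \<in> space M \<Longrightarrow>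
      P_d p N (\<lambda>s y x. \<exists>t\<in>T. \<bar>h N s y x t\<bar> > C) \<omega> \<le> \<eta> / 2 + B N \<omega>"
    using insert.IH[of "\<eta> / 2"] insert.prems by (meson half_gt_zero insert_subset)
  have "t \<in> F" "0 < \<eta> / 2"
    using insert.prems by auto
  then obtain C' B' where CB': "null B'" "\<And>N \<omega>. N \<ge> 1 \<Longrightarrow> \<omega> \<in> space M \<Longrightarrow>
      P_d p N (\<lambda>s y x. \<bar>h N s y x t\<bar> \<le> C') \<omega> + B' N \<omega> \<ge> 1 - \<eta> / 2"
    using marg unfolding marginals_cond_asymp_tight_def by meson
  have "P_d p N (\<lambda>s y x. \<exists>t\<in>insert t T. \<bar>h N s y x t\<bar> > max C C') \<omega> \<le> \<eta> + (B N \<omega> + B' N \<omega>)"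
    if N: "N \<ge> 1" "\<omega> \<in> space M" for N \<omega>
  proof -
    have "P_d p N (\<lambda>s y x. \<exists>t\<in>insert t T. \<bar>h N s y x t\<bar> > max C C') \<omega>
        \<le> P_d p N (\<lambda>s y x. \<exists>t\<in>T. \<bar>h N s y x t\<bar> > C) \<omega> + P_d p N (\<lambda>s y x. \<not> \<bar>h N s y x t\<bar> \<le> C') \<omega>"
      by (intro P_d_Un_le N) auto
    then show ?thesis
      using CB(2)[OF N] CB'(2)[OF N] P_d_not[OF N, of "\<lambda>s y x. \<bar>h N s y x t\<bar> \<le> C'"] by linarith
  qed
  then show ?case
    using null_add[OF CB(1) CB'(1)] by blast
qed

text \<open>One scale of the compactness construction. Half of \<open>\<eta>\<close> pays for large
  oscillation and half for large values at the representatives; oscillation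
  \<open>\<epsilon> / 4\<close> yields a net of radius \<open>\<epsilon>\<close>.\<close>

lemma oscillation_bounded_likely:
  assumes marg: "marginals_cond_asymp_tight M null p F h"
    and part: "cond_asymp_partitionable M null p F h"
    and "0 < \<epsilon>" "0 < \<eta>"
  shows "\<exists>V A Z. closedin (mtopology_of (linf F)) V \<and> finite Z \<and> Z \<subseteq> mspace (linf F) \<and>
    V \<subseteq> (\<Union>z\<in>Z. Metric_space.mball (mspace (linf F)) (mdist (linf F)) z \<epsilon>) \<and>
    null A \<and> (\<forall>N\<ge>1. \<forall>\<omega>\<in>space M. P_d p N (\<lambda>s y x. h N s y x \<notin> V) \<omega> \<le> \<eta> + A N \<omega>)"
proof -
  have "0 < \<epsilon> / 4" "0 < \<eta> / 2"
    using \<open>0 < \<epsilon>\<close> \<open>0 < \<eta>\<close> by auto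
  let ?E = "\<lambda>\<P> N s y x. (SUP G\<in>\<P>. SUP (f, g)\<in>G \<times> G. ereal \<bar>h N s y x f - h N s y x g\<bar>) > ereal (\<epsilon> / 4)"
  have "\<exists>\<P>. partition_on F \<P> \<and> finite \<P> \<and>
      (\<exists>A. null A \<and> (\<forall>N\<ge>1. \<forall>\<omega>\<in>space M. P_d p N (?E \<P> N) \<omega> < \<eta> / 2 + A N \<omega>))"
    using part[unfolded cond_asymp_partitionable_def, rule_format, OF \<open>0 < \<epsilon> / 4\<close> \<open>0 < \<eta> / 2\<close>] .
  then obtain \<P> A where "partition_on F \<P>" "finite \<P>" and A: "null A"
    "\<And>N \<omega>. N \<ge> 1 \<Longrightarrow> \<omega> \<in> space M \<Longrightarrow> P_d p N (?E \<P> N) \<omega> < \<eta> / 2 + A N \<omega>"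
    by blast
  have \<P>: "\<Union>\<P> = F" "{} \<notin> \<P>"
    using \<open>partition_on F \<P>\<close> by (auto simp: partition_on_def)
  define T where "T = (\<lambda>G. SOME f. f \<in> G) ` \<P>"
  have rep: "(SOME f. f \<in> G) \<in> G" if "G \<in> \<P>" for G
    using that \<P>(2) by (metis some_in_eq)
  have T: "finite T" "T \<subseteq> F" "\<And>G. G \<in> \<P> \<Longrightarrow> G \<inter> T \<noteq> {}"
    using \<open>finite \<P>\<close> rep \<P>(1) unfolding T_def by blast+
  obtain C B where B: "null B" "\<And>N \<omega>. N \<ge> 1 \<Longrightarrow> \<omega> \<in> space M \<Longrightarrow>
      P_d p N (\<lambda>s y x. \<exists>t\<in>T. \<bar>h N s y x t\<bar> > C) \<omega> \<le> \<eta> / 2 + B N \<omega>"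
    using marginals_finite_bound[OF marg T(1,2) \<open>0 < \<eta> / 2\<close>] by blast
  let ?V = "oscillation_bounded F \<P> T (\<epsilon> / 4) C"
  obtain Z where Z: "finite Z" "Z \<subseteq> mspace (linf F)"
    "?V \<subseteq> (\<Union>z\<in>Z. Metric_space.mball (mspace (linf F)) (mdist (linf F)) z \<epsilon>)"
    using oscillation_bounded_finite_net[OF \<P>(1) T \<open>0 < \<epsilon> / 4\<close>, of C] by auto
  have "P_d p N (\<lambda>s y x. h N s y x \<notin> ?V) \<omega> \<le> \<eta> + (A N \<omega> + B N \<omega>)"
    if N: "N \<ge> 1" "\<omega> \<in> space M" for N \<omega>
  proof -
    have "P_d p N (\<lambda>s y x. h N s y x \<notin> ?V) \<omega>
        \<le> P_d p N (?E \<P> N) \<omega> + P_d p N (\<lambda>s y x. \<exists>t\<in>T. \<bar>h N s y x t\<bar> > C) \<omega>"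
    proof (intro P_d_Un_le N)
      fix s y x
      assume "h N s y x \<in> mspace (linf F)" "h N s y x \<notin> ?V"
      \<comment> \<open>A bounded function outside the set violates either a bound on
        \<open>T\<close> or the oscillation bound on a cell.\<close>
      then consider t where "t \<in> T" "\<bar>h N s y x t\<bar> > C"
        | G f g where "G \<in> \<P>" "f \<in> G" "g \<in> G" "\<bar>h N s y x f - h N s y x g\<bar> > \<epsilon> / 4"
        unfolding oscillation_bounded_def by force
      then show "?E \<P> N s y x \<or> (\<exists>t\<in>T. \<bar>h N s y x t\<bar> > C)"
      proof cases
        case 2
        have "?E \<P> N s y x"
          unfolding less_SUP_iff using 2 by (intro bexI[of _ G] bexI[of _ "(f, g)"]) auto
        then show ?thesis ..
      qed blast
    qed
    then show ?thesis
      using A(2)[OF N] B(2)[OF N] by linarith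
  qed
  moreover have "closedin (mtopology_of (linf F)) ?V"
    using \<P>(1) T(2) by (intro closedin_oscillation_bounded) auto
  ultimately show ?thesis
    using Z null_add[OF A(1) B(1)] by blast
qed

text \<open>The compact set has to be fixed before \<open>\<delta>\<close>, but the null sequence
  may depend on \<open>\<delta>\<close>. This permits stopping at a finite intersection
  \<open>U n\<close> that lies in the given enlargement.\<close>

lemma partitionable_imp_tight:
  assumes marg: "marginals_cond_asymp_tight M null p F h"
    and part: "cond_asymp_partitionable M null p F h"
  shows "cond_asymp_tight M null p F h"
  unfolding cond_asymp_tight_def
proof (intro allI impI)
  fix \<eta> :: real assume "0 < \<eta>"
  interpret linf: Metric_space "mspace (linf F)" "mdist (linf F)"
    by (rule Metric_space_linf)
  have "\<exists>V A Z. closedin linf.mtopology V \<and> finite Z \<and> Z \<subseteq> mspace (linf F) \<and>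
      V \<subseteq> (\<Union>z\<in>Z. linf.mball z (inverse (real (Suc m)))) \<and> null A \<and>
      (\<forall>N\<ge>1. \<forall>\<omega>\<in>space M. P_d p N (\<lambda>s y x. h N s y x \<notin> V) \<omega> \<le> \<eta> * (1 / 2) ^ Suc m + A N \<omega>)" for m
    using oscillation_bounded_likely[OF marg part] \<open>0 < \<eta>\<close> by (simp add: mtopology_of_linf)
  then obtain V A Z where V: "\<And>m. closedin linf.mtopology (V m)"
    and Z: "\<And>m. finite (Z m)" "\<And>m. Z m \<subseteq> mspace (linf F)"
      "\<And>m. V m \<subseteq> (\<Union>z\<in>Z m. linf.mball z (inverse (real (Suc m))))"
    and A: "\<And>m. null (A m)" "\<And>m N \<omega>. N \<ge> 1 \<Longrightarrow> \<omega> \<in> space M \<Longrightarrow>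
      P_d p N (\<lambda>s y x. h N s y x \<notin> V m) \<omega> \<le> \<eta> * (1 / 2) ^ Suc m + A m N \<omega>"
    by metis
  define U where "U n = (\<Inter>m\<le>n. V m)" for n
  have "decseq U"
    unfolding decseq_def U_def by (auto intro: order_trans)
  have U_closed: "closedin linf.mtopology (U n)" for n
    unfolding U_def using V by (intro closedin_INT) auto
  \<comment> \<open>Since \<open>U m\<close> is contained in \<open>V m\<close>, it inherits the net
    of radius \<open>1 / (m + 1)\<close>.\<close>
  have U_net: "\<exists>n T. finite T \<and> T \<subseteq> mspace (linf F) \<and> U n \<subseteq> (\<Union>z\<in>T. linf.mball z \<epsilon>)"
    if "0 < \<epsilon>" for \<epsilon>
  proof -
    obtain m where "inverse (real (Suc m)) < \<epsilon>"
      using reals_Archimedean[OF \<open>0 < \<epsilon>\<close>] by blast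
    then have "linf.mball z (inverse (real (Suc m))) \<subseteq> linf.mball z \<epsilon>" for z
      by (intro linf.mball_subset_concentric) simp
    then have "V m \<subseteq> (\<Union>z\<in>Z m. linf.mball z \<epsilon>)"
      using Z(3)[of m] by blast
    moreover have "U m \<subseteq> V m"
      by (auto simp: U_def)
    ultimately show ?thesis
      using Z(1,2)[of m] by blast
  qed
  let ?K = "\<Inter>n. U n"
  have K: "compactin (mtopology_of (linf F)) ?K"
    unfolding mtopology_of_linf
    by (rule linf.compactin_INT_decseq_nets[OF mcomplete_linf \<open>decseq U\<close> U_closed U_net])
  have likely: "\<exists>B. null B \<and> (\<forall>N\<ge>1. \<forall>\<omega>\<in>space M.
      P_d p N (\<lambda>s y x. h N s y x \<in> enlargement F ?K \<delta>) \<omega> + B N \<omega> \<ge> 1 - \<eta>)" if "0 < \<delta>" for \<delta>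
  proof -
    obtain n where n: "U n \<subseteq> enlargement F ?K \<delta>"
      using linf.decseq_nets_subset_enlargement[OF mcomplete_linf \<open>decseq U\<close> U_closed U_net \<open>0 < \<delta>\<close>]
      unfolding enlargement_def by blast
    have "1 - \<eta> \<le> P_d p N (\<lambda>s y x. h N s y x \<in> enlargement F ?K \<delta>) \<omega> + (\<Sum>m\<le>n. A m N \<omega>)"
      if N: "N \<ge> 1" "\<omega> \<in> space M" for N \<omega>
    proof -
      have "(\<Sum>m\<le>n. (1 / 2 :: real) ^ Suc m) = 1 - (1 / 2) ^ Suc n"
        by (induction n) (auto simp: field_simps)
      then have geometric: "(\<Sum>m\<le>n. (1 / 2 :: real) ^ Suc m) \<le> 1"
        by simp
      \<comment> \<open>Leaving the enlargement means leaving \<open>U n\<close>, hence leaving some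
        \<open>V m\<close> with \<open>m \<le> n\<close>; the union bound stays finite.\<close>
      have "P_d p N (\<lambda>s y x. \<not> h N s y x \<in> enlargement F ?K \<delta>) \<omega>
          \<le> (\<Sum>m\<le>n. P_d p N (\<lambda>s y x. h N s y x \<notin> V m) \<omega>)"
      proof (rule P_d_UN_le[OF N])
        fix s y x assume "\<not> h N s y x \<in> enlargement F ?K \<delta>"
        then have "h N s y x \<notin> U n"
          using n by blast
        then show "\<exists>m\<in>{..n}. h N s y x \<notin> V m"
          by (simp add: U_def)
      qed simp
      also have "\<dots> \<le> (\<Sum>m\<le>n. \<eta> * (1 / 2) ^ Suc m + A m N \<omega>)"
        by (intro sum_mono A(2) N)
      also have "\<dots> = \<eta> * (\<Sum>m\<le>n. (1 / 2) ^ Suc m) + (\<Sum>m\<le>n. A m N \<omega>)"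
        by (simp only: sum.distrib sum_distrib_left)
      also have "\<dots> \<le> \<eta> + (\<Sum>m\<le>n. A m N \<omega>)"
        using mult_left_mono[OF geometric, of \<eta>] \<open>0 < \<eta>\<close> by simp
      finally show ?thesis
        unfolding P_d_not[OF N] by linarith
    qed
    moreover have "null (\<lambda>N \<omega>. \<Sum>m\<le>n. A m N \<omega>)"
      by (intro null_sum A(1)) simp
    ultimately show ?thesis
      by blast
  qed
  show "\<exists>K. compactin (mtopology_of (linf F)) K \<and> (\<forall>\<delta>>0. \<exists>A. null A \<and>
      (\<forall>N\<ge>1. \<forall>\<omega>\<in>space M. P_d p N (\<lambda>s y x. h N s y x \<in> enlargement F K \<delta>) \<omega> + A N \<omega> \<ge> 1 - \<eta>))"
  proof (intro exI[of _ ?K] conjI allI impI)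
    show "compactin (mtopology_of (linf F)) ?K"
      by (rule K)
  qed (rule likely)
qed

end

section \<open>Selection vectors of positive probability\<close>

text \<open>The law of \<open>D\<close> gives the interval mass \<open>b - a > 0\<close>, so its
  preimage cannot be empty.\<close>

lemma uniform01_hits_interval:
  assumes "prob_space Md" "uniform01 Md D" "0 \<le> a" "a < b" "b \<le> 1"
  obtains d where "d \<in> space Md" "a < D d" "D d \<le> b"
proof (rule ccontr)
  assume "\<not> thesis"
  then have "D -` {a<..b} \<inter> space Md = {}"
    using that by auto
  moreover have D: "D \<in> borel_measurable Md" "distr Md borel D = uniform_measure lborel {0..1}"
    using assms(2) by (auto simp: uniform01_def)
  ultimately have "emeasure (uniform_measure lborel {0..1::real}) {a<..b} = 0"
    using emeasure_distr[OF D(1), of "{a<..b}"] by simp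
  moreover have "{0..1} \<inter> {a<..b} = {a<..b}"
    using assms(3,5) by auto
  then have "emeasure (uniform_measure lborel {0..1::real}) {a<..b} = ennreal (b - a)"
    using \<open>a < b\<close> by (simp add: divide_ennreal_def)
  ultimately show False
    using \<open>a < b\<close> by simp
qed

text \<open>Nonnegative weights make the partial sums monotone, so the half-open intervals between
  consecutive sums are disjoint and the index described by \<open>THE\<close> is unique.\<close>

lemma Svec_eq_enum:
  assumes i: "i \<in> {1..2 ^ N}"
    and p_nonneg: "\<And>j. j \<in> {1..2 ^ N} \<Longrightarrow> 0 \<le> p N (enum N j) (Xvec N \<omega>)"
    and lower: "(\<Sum>j\<in>{1..<i}. p N (enum N j) (Xvec N \<omega>)) < D (snd \<omega>)"
    and upper: "D (snd \<omega>) \<le> (\<Sum>j\<in>{1..i}. p N (enum N j) (Xvec N \<omega>))"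
  shows "Svec p enum D N \<omega> = enum N i"
\<comment> \<open>The first branch of \<open>Svec\<close> tests the upper bound only, so index 1 is
  separate; for \<open>i > 1\<close> that branch has to be ruled out.\<close>
proof (cases "i = 1")
  case True
  then show ?thesis
    using upper by (simp add: Svec_def)
next
  case False
  let ?q = "\<lambda>j. p N (enum N j) (Xvec N \<omega>)"
  have mono: "sum ?q I \<le> sum ?q J" if "I \<subseteq> J" "J \<subseteq> {1..2 ^ N}" for I J
    using that p_nonneg by (intro sum_mono2) (auto intro: finite_subset)
  have "{1} \<subseteq> {1..<i}" "{1..<i} \<subseteq> {1..2 ^ N}"
    using False i by auto
  then have "?q 1 \<le> (\<Sum>j\<in>{1..<i}. ?q j)"
    using mono[of "{1}" "{1..<i}"] by simp
  then have "\<not> D (snd \<omega>) \<le> ?q 1"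
    using lower by linarith
  moreover have "(THE k. k \<in> {1..2 ^ N} \<and> (\<Sum>j\<in>{1..<k}. ?q j) < D (snd \<omega>) \<and> D (snd \<omega>) \<le> (\<Sum>j\<in>{1..k}. ?q j)) = i"
  proof (rule the_equality)
    fix k assume k: "k \<in> {1..2 ^ N} \<and> (\<Sum>j\<in>{1..<k}. ?q j) < D (snd \<omega>) \<and> D (snd \<omega>) \<le> (\<Sum>j\<in>{1..k}. ?q j)"
    have "\<not> k < i"
      using mono[of "{1..k}" "{1..<i}"] lower i k by fastforce
    moreover have "\<not> i < k"
      using mono[of "{1..i}" "{1..<k}"] upper i k by fastforce
    ultimately show "k = i"
      by simp
  qed (use i lower upper in blast)
  ultimately show ?thesis
    by (simp add: Svec_def)
qed

text \<open>The interval that selects \<open>s\<close> has length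
  \<open>p N s (Xvec N \<omega>)\<close>, hence \<open>D\<close> hits it at some \<open>d\<close>.
  Replacing the last coordinate by \<open>d\<close> leaves \<open>Xvec\<close>, and with it all the
  intervals, unchanged.\<close>

lemma positive_probability_attained:
  assumes "prob_space Md" "uniform01 Md D" and enum: "bij_betw (enum N) {1..2 ^ N} (binvecs N)"
    and nonneg: "\<And>s. s \<in> binvecs N \<Longrightarrow> 0 \<le> p N s (Xvec N \<omega>)"
    and sum: "(\<Sum>s\<in>binvecs N. p N s (Xvec N \<omega>)) = 1"
    and "s \<in> binvecs N" "0 < p N s (Xvec N \<omega>)"
  obtains d where "d \<in> space Md" "Svec p enum D N (fst \<omega>, d) = s"
proof -
  let ?q = "\<lambda>j. p N (enum N j) (Xvec N \<omega>)"
  obtain i where i: "i \<in> {1..2 ^ N}" "enum N i = s"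
    using bij_betw_imp_surj_on[OF enum] \<open>s \<in> binvecs N\<close> by (metis imageE)
  have q_nonneg: "0 \<le> ?q j" if "j \<in> {1..2 ^ N}" for j
    by (rule nonneg[OF bij_betw_apply[OF enum that]])
  have total: "(\<Sum>j\<in>{1..2 ^ N}. ?q j) = 1"
    using sum.reindex_bij_betw[OF enum, of "\<lambda>s. p N s (Xvec N \<omega>)"] sum by simp
  have lower: "0 \<le> (\<Sum>j\<in>{1..<i}. ?q j)"
    using q_nonneg i(1) by (intro sum_nonneg) auto
  have "{1..i} = insert i {1..<i}"
    using i(1) by auto
  then have less: "(\<Sum>j\<in>{1..<i}. ?q j) < (\<Sum>j\<in>{1..i}. ?q j)"
    using i(2) assms(7) by simp
  have upper: "(\<Sum>j\<in>{1..i}. ?q j) \<le> 1"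
    unfolding total[symmetric] using q_nonneg i(1) by (intro sum_mono2) auto
  obtain d where d: "d \<in> space Md" "(\<Sum>j\<in>{1..<i}. ?q j) < D d" "D d \<le> (\<Sum>j\<in>{1..i}. ?q j)"
    using uniform01_hits_interval[OF assms(1,2) lower less upper] by blast
  have "Xvec N (fst \<omega>, d) = Xvec N \<omega>"
    by (simp add: Xvec_def)
  then have "Svec p enum D N (fst \<omega>, d) = enum N i"
    using d(2,3) q_nonneg i(1) by (intro Svec_eq_enum) simp_all
  then show ?thesis
    using that d(1) i(2) by simp
qed

section \<open>The equivalences in both modes of convergence\<close>

text \<open>The conditions refer to the factorisation \<open>h\<close>, because \<open>P_d\<close>
  varies the selection vector while the data stay fixed; \<open>H\<close> is \<open>h\<close> at the
  realised vector. The proof checks the locale assumptions for either mode and closes the cycle of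
  implications.\<close>

theorem theorem1:
  fixes MY :: "'y measure" and MX :: "'x measure"
    and Q :: "('y \<times> 'x) measure" and Md :: "'d measure"
    and M :: "((nat \<Rightarrow> 'y \<times> 'x) \<times> 'd) measure"
    and D :: "'d \<Rightarrow> real"
    and p :: "nat \<Rightarrow> (nat \<Rightarrow> nat) \<Rightarrow> (nat \<Rightarrow> 'x) \<Rightarrow> real"
    and enum :: "nat \<Rightarrow> nat \<Rightarrow> nat \<Rightarrow> nat"
    and F :: "'f set"
    and H :: "nat \<Rightarrow> (nat \<Rightarrow> 'y \<times> 'x) \<times> 'd \<Rightarrow> 'f \<Rightarrow> real"
    and h :: "nat \<Rightarrow> (nat \<Rightarrow> nat) \<Rightarrow> (nat \<Rightarrow> 'y) \<Rightarrow> (nat \<Rightarrow> 'x) \<Rightarrow> 'f \<Rightarrow> real"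
  assumes "prob_space Q" and "sets Q = sets (MY \<Otimes>\<^sub>M MX)"
    and "prob_space Md" and "uniform01 Md D"
    and M_def: "M = sample_space Q Md"
    and "sampling_design MX p"
    and "\<And>N. N \<ge> 1 \<Longrightarrow> bij_betw (enum N) {1..2 ^ N} (binvecs N)"
    and "\<And>N \<omega>. N \<ge> 1 \<Longrightarrow> \<omega> \<in> space M \<Longrightarrow> H N \<omega> \<in> mspace (linf F)"
    and "\<And>N \<omega>. N \<ge> 1 \<Longrightarrow> \<omega> \<in> space M \<Longrightarrow>
           H N \<omega> = h N (Svec p enum D N \<omega>) (Yvec N \<omega>) (Xvec N \<omega>)"
    and "\<And>N f. N \<ge> 1 \<Longrightarrow> f \<in> F \<Longrightarrow> (\<lambda>\<omega>. H N \<omega> f) \<in> borel_measurable M"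
  shows "\<forall>null\<in>{null_in_probability M, null_almost_surely M}.
           (cond_asymp_tight M null p F h \<longleftrightarrow>
              marginals_cond_asymp_tight M null p F h \<and>
              (\<exists>\<rho>. semimetric_on F \<rho> \<and> totally_bounded_semimetric F \<rho> \<and>
                   cond_asymp_equicontinuous M null p F h \<rho>)) \<and>
           (cond_asymp_tight M null p F h \<longleftrightarrow>
              marginals_cond_asymp_tight M null p F h \<and>
              cond_asymp_partitionable M null p F h)"
proof
  fix null assume null: "null \<in> {null_in_probability M, null_almost_surely M}"
  interpret M: prob_space M
    unfolding M_def sample_space_def by (intro prob_space_pair prob_space_PiM assms)
  have space_M: "space M = ({1..} \<rightarrow>\<^sub>E space Q) \<times> space Md"
    by (simp add: M_def sample_space_def space_pair_measure space_PiM)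
  have space_Q: "space Q = space MY \<times> space MX"
    using sets_eq_imp_space_eq[OF assms(2)] by (simp add: space_pair_measure)
  have X: "Xvec N \<omega> \<in> space (\<Pi>\<^sub>M i\<in>{1..N}. MX)" if "\<omega> \<in> space M" for N \<omega>
    using that unfolding space_M space_Q by (auto simp: Xvec_def space_PiM PiE_iff mem_Times_iff)
  interpret conditional_design M null p F h
  proof
    fix N \<omega> s
    assume N: "(1::nat) \<le> N" "\<omega> \<in> space M"
    show p_sum: "(\<Sum>s\<in>binvecs N. p N s (Xvec N \<omega>)) = 1"
      using \<open>sampling_design MX p\<close> N X[OF N(2)] unfolding sampling_design_def by blast
    assume s: "s \<in> binvecs N"
    have p_nonneg: "0 \<le> p N s (Xvec N \<omega>)" if "s \<in> binvecs N" for s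
      using \<open>sampling_design MX p\<close> N X[OF N(2)] that unfolding sampling_design_def by blast
    then show "0 \<le> p N s (Xvec N \<omega>)"
      using s .
    assume pos: "0 < p N s (Xvec N \<omega>)"
    \<comment> \<open>Boundedness is known for \<open>H\<close> only. Changing the last coordinate
      realises \<open>s\<close> with the same data, so the value of \<open>h\<close> at
      \<open>s\<close> is a value of \<open>H\<close>.\<close>
    obtain d where d: "d \<in> space Md" "Svec p enum D N (fst \<omega>, d) = s"
      using positive_probability_attained[of Md D enum N p \<omega> s,
          OF assms(3,4) assms(7)[OF N(1)] p_nonneg p_sum s pos] by blast
    have \<omega>': "(fst \<omega>, d) \<in> space M"
      using N(2) d(1) by (auto simp: space_M)
    have "Yvec N (fst \<omega>, d) = Yvec N \<omega>" "Xvec N (fst \<omega>, d) = Xvec N \<omega>"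
      by (simp_all add: Yvec_def Xvec_def)
    then show "h N s (Yvec N \<omega>) (Xvec N \<omega>) \<in> mspace (linf F)"
      using assms(8)[OF N(1) \<omega>'] assms(9)[OF N(1) \<omega>'] d(2) by simp
  next
    show "null (\<lambda>N \<omega>. 0)"
      using null by (auto simp: null_in_probability_def null_almost_surely_def)
  next
    show "null (\<lambda>N \<omega>. A N \<omega> + B N \<omega>)" if "null A" "null B" for A B
      using null that null_in_probability_add[OF M.finite_measure_axioms] null_almost_surely_add by auto
  qed
  show "(cond_asymp_tight M null p F h \<longleftrightarrow>
           marginals_cond_asymp_tight M null p F h \<and>
           (\<exists>\<rho>. semimetric_on F \<rho> \<and> totally_bounded_semimetric F \<rho> \<and>
                cond_asymp_equicontinuous M null p F h \<rho>)) \<and>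
        (cond_asymp_tight M null p F h \<longleftrightarrow>
           marginals_cond_asymp_tight M null p F h \<and> cond_asymp_partitionable M null p F h)"
    using tight_imp_marginals tight_imp_equicontinuous equicontinuous_imp_partitionable
      partitionable_imp_tight by metis
qed

end
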